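(* Let $(\mathcal{M},g_{ab})$ be a $(3+1)$-dimensional globally hyperbolic Lorentzian spacetime with global time function $t$ (from a foliation by Cauchy surfaces $\Sigma_t$), carrying a free real scalar Klein-Gordon field in a quasifree state $\omega$ (for instance a vacuum state) with smeared Wightman function $\mathsf{W}(\cdot,\cdot)$. Let $A,B$ be two qubit detectors on static trajectories, each coupled to the field by a delta coupling: detector $j\in\{A,B\}$ interacts at the single instant $\tau_j=\tau_{j,0}$ of its proper time, with spacetime smearing $$f_j(\mathsf{x})=\lambda_j\,\eta\,\delta(\tau_j-\tau_{j,0})\,F_j(\bar{\boldsymbol{x}}),$$ and the interactions are time-ordered as $t(\tau_{A,0})<t(\tau_{B,0})$. The total evolution is then $U=U_BU_A$ with $$U_j=\exp\!\big[-i\,\hat\mu_j\otimes\hat\phi(f_j)\big]=\mathbb{1}\otimes\cos\hat\phi(f_j)-i\,\hat\mu_j\otimes\sin\hat\phi(f_j),\qquad \hat\mu_j=\hat\mu_j(\tau_{j,0}).$$ Let the initial state be $\hat\rho_A\otimes\hat\rho_B\otimes\hat\rho_\phi$, where $\hat\rho_A=|e_A\rangle\langle e_A|$, $\hat\rho_B$ is an arbitrary density matrix of qubit $B$, and $\hat\rho_\phi$ represents $\omega$. Define the channel $$\Phi(\hat\rho_B)=\mathrm{tr}_{A,\phi}\big(U(\hat\rho_A\otimes\hat\rho_B\otimes\hat\rho_\phi)U^\dagger\big).$$ If $\mathrm{supp}(f_A)$ and $\mathrm{supp}(f_B)$ are spacelike separated, then $\Phi$ is the Pauli channel $$\Phi(\hat\rho_B)=(1-p)\,\hat\rho_B+p\,\hat\mu_B\hat\rho_B\hat\mu_B,\qquad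 p=\frac{1-e^{-2\mathsf{W}(f_B,f_B)}}{2}.$$ Consequently, if $B$ starts in its ground state, the excitation probability, defined as $$\Pr(|g_B\rangle\to|e_B\rangle)=\big|\langle e_B|\Phi(|g_B\rangle\langle g_B|)|e_B\rangle\big|^2,$$ is purely a function of $f_B$ and is independent of $f_A$. This independence of $f_A$ does not rely on the choice of initial state of $B$.
   Context: Field. The Klein-Gordon operator is $P=\nabla_a\nabla^a-m^2-\xi R$ with $\xi\ge0$, $R$ the Ricci scalar and $\nabla$ the Levi-Civita connection of $g_{ab}$. Let $E^+,E^-$ be its retarded and advanced propagators ($P(E^\pm f)=f$), $E=E^--E^+$ the causal propagator, and $E(f,g)=\int_{\mathcal{M}}dV\,f(\mathsf{x})(Eg)(\mathsf{x})$ with $dV=\sqrt{-g}\,d^4\mathsf{x}$. One has $E(f,g)=0$ when the supports of $f$ and $g$ are spacelike separated (causally disjoint). Weyl algebra. The Weyl algebra $\mathcal{W}(\mathcal{M})$ is the unital $C^*$-algebra generated by elements $W(Ef)$, formally $e^{i\hat\phi(f)}$ with $\hat\phi(f)=\int dV\,f(\mathsf{x})\hat\phi(\mathsf{x})$ the smeared field, for real $f\in C_0^\infty(\mathcal{M})$, with relations $W(Ef)^\dagger=W(-Ef)$, $W(E(Pf))=\mathbb{1}$, $W(Ef)W(Eg)=e^{-\frac{i}{2}E(f,g)}W(E(f+g))$. Here $\cos\hat\phi(f)=\frac12(W(Ef)+W(-Ef))$ and $\sin\hat\phi(f)=\frac1{2i}(W(Ef)-W(-Ef))$. A state is a normalized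 positive linear functional on $\mathcal{W}(\mathcal{M})$. Quasifree states. Let $\mathsf{Sol}_{\mathbb{R}}(\mathcal{M})$ be the space of real solutions of $P\phi=0$ with compact Cauchy data; these are the functions $Ef$. A state $\omega$ is quasifree if there is a real inner product $\mu$ on this space with $|E(f,g)|^2\le4\mu(Ef,Ef)\mu(Eg,Eg)$ such that $\omega(W(Ef))=e^{-\mu(Ef,Ef)/2}$. Its smeared Wightman function is $\mathsf{W}(f,g)=\omega(\hat\phi(f)\hat\phi(g))=\mu(Ef,Eg)+\frac i2E(f,g)$, so $\mathsf{W}(f,f)=\mu(Ef,Ef)$. That $\hat\rho_\phi$ represents $\omega$ means that, in a Hilbert space representation of $\mathcal{W}(\mathcal{M})$ (such as the GNS representation of $\omega$), $\mathrm{tr}(\hat\rho_\phi X)=\omega(X)$ for all $X\in\mathcal{W}(\mathcal{M})$. Detectors. Qubit $j$ has ground and excited states $|g_j\rangle,|e_j\rangle$ of energies $0,\Omega_j$, and monopole operator $\hat\mu_j(\tau_j)=|e_j\rangle\langle g_j|\,e^{i\Omega_j\tau_j}+|g_j\rangle\langle e_j|\,e^{-i\Omega_j\tau_j}$. Here $\tau_j$ is the proper time of detector $j$, $(\tau_j,\bar{\boldsymbol{x}})$ are local rest-frame coordinates of the detector (e.g. Fermi normal coordinates, with the centre of mass at $\bar{\boldsymbol{x}}=0$), $F_j$ is its spatial profile with $f_A,f_B$ of compact, non-overlapping supports, $\lambda_j$ is a coupling constant, and $\eta$ is a constant with dimension of length, taken equal for both detectors. Static trajectories means that $t$ depends only on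 $\tau_j$ along the interaction of detector $j$, not on the spatial coordinates. In $U_j$, $\hat\mu_j$ acts on qubit $j$, the cosine and sine act on the field, and the identity acts on the other qubit. Everything is in the interaction picture; $\mathrm{tr}_{A,\phi}$ is the partial trace over qubit $A$ and the field. Delta smearings. The functions $f_A,f_B$ are not elements of $C_0^\infty(\mathcal{M})$; they are idealizations of smooth compactly supported functions very localized in time, and the Weyl relations, the causality property of $E$ and the quasifree formula above are applied to them formally. *)

theory Defs
  imports "HOL-Analysis.Analysis"
begin

section \<open>Smooth four-manifolds\<close>

definition pd :: "4 \<Rightarrow> (real^4 \<Rightarrow> real) \<Rightarrow> real^4 \<Rightarrow> real" where
  "pd i u y = frechet_derivative u (at y) (axis i 1)"

primrec Ck_on :: "nat \<Rightarrow> (real^4) set \<Rightarrow> (real^4 \<Rightarrow> real) \<Rightarrow> bool" where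
  "Ck_on 0 S u \<longleftrightarrow> continuous_on S u"
| "Ck_on (Suc k) S u \<longleftrightarrow> u differentiable_on S \<and> (\<forall>i. Ck_on k S (pd i u))"

text \<open>This is only used for open \<open>S\<close>.\<close>

definition smooth_on :: "(real^4) set \<Rightarrow> (real^4 \<Rightarrow> real) \<Rightarrow> bool" where
  "smooth_on S u \<longleftrightarrow> (\<forall>k. Ck_on k S u)"

text \<open>A chart is a pair of a domain and a coordinate map; the values of the map outside the domain
  are irrelevant.\<close>

type_synonym 'a chart = "'a set \<times> ('a \<Rightarrow> real^4)"

abbreviation dom_of :: "'a chart \<Rightarrow> 'a set" where "dom_of c \<equiv> fst c"

definition img_of :: "'a chart \<Rightarrow> (real^4) set" where
  "img_of c = snd c ` fst c"

definition point_at :: "'a chart \<Rightarrow> real^4 \<Rightarrow> 'a" where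
  "point_at c = inv_into (fst c) (snd c)"

definition in_chart :: "'a chart \<Rightarrow> ('a \<Rightarrow> 'b) \<Rightarrow> real^4 \<Rightarrow> 'b" where
  "in_chart c h y = h (point_at c y)"

definition is_chart :: "'a::topological_space chart \<Rightarrow> bool" where
  "is_chart c \<longleftrightarrow> open (dom_of c) \<and> open (img_of c) \<and>
     homeomorphism (dom_of c) (img_of c) (snd c) (point_at c)"

definition smooth_transition :: "'a chart \<Rightarrow> 'a chart \<Rightarrow> bool" where
  "smooth_transition c d \<longleftrightarrow>
     (\<forall>i. smooth_on (snd c ` (dom_of c \<inter> dom_of d)) (\<lambda>y. in_chart c (snd d) y $ i))"

definition maximal_smooth_atlas :: "'a::topological_space chart set \<Rightarrow> bool" where
  "maximal_smooth_atlas \<A> \<longleftrightarrow>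
     (\<Union>c\<in>\<A>. dom_of c) = UNIV \<and> (\<forall>c\<in>\<A>. is_chart c) \<and>
     (\<forall>c\<in>\<A>. \<forall>d\<in>\<A>. smooth_transition c d) \<and>
     (\<forall>c. is_chart c \<and> (\<forall>d\<in>\<A>. smooth_transition c d \<and> smooth_transition d c) \<longrightarrow> c \<in> \<A>)"

section \<open>Globally hyperbolic spacetimes\<close>

text \<open>The manifold is the whole type \<open>'a\<close>. The metric is given by its matrix of components in each
  chart. The signature is $(-,+,+,+)$ and the time index is \<open>1 :: 4\<close>. Future-directed means that
  the time function increases.\<close>

record 'a spacetime =
  atlas :: "'a chart set"
  metric :: "'a chart \<Rightarrow> real^4 \<Rightarrow> real^4^4"
  time_fn :: "'a \<Rightarrow> real"

definition smooth_functions :: "'a spacetime \<Rightarrow> ('a \<Rightarrow> real) set" where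
  "smooth_functions M = {h. \<forall>c\<in>atlas M. smooth_on (img_of c) (in_chart c h)}"

definition supp :: "('a::topological_space \<Rightarrow> real) \<Rightarrow> 'a set" where
  "supp h = closure {x. h x \<noteq> 0}"

definition test_functions :: "'a::topological_space spacetime \<Rightarrow> ('a \<Rightarrow> real) set" where
  "test_functions M = {h \<in> smooth_functions M. compact (supp h)}"

definition minkowski :: "real^4^4" where
  "minkowski = (\<chi> i j. if i = j then (if i = 1 then -1 else 1) else 0)"

definition lorentzian :: "real^4^4 \<Rightarrow> bool" where
  "lorentzian g \<longleftrightarrow> transpose g = g \<and>
     (\<exists>B. invertible B \<and> transpose B ** g ** B = minkowski)"

definition lorentzian_metric :: "'a spacetime \<Rightarrow> bool" where
  "lorentzian_metric M \<longleftrightarrow>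
     (\<forall>c\<in>atlas M. (\<forall>a b. smooth_on (img_of c) (\<lambda>y. metric M c y $ a $ b)) \<and>
        (\<forall>y\<in>img_of c. lorentzian (metric M c y))) \<and>
     (\<forall>c\<in>atlas M. \<forall>d\<in>atlas M. \<forall>p\<in>dom_of c \<inter> dom_of d.
        let J = matrix (frechet_derivative (in_chart c (snd d)) (at (snd c p)))
        in metric M c (snd c p) = transpose J ** metric M d (snd d p) ** J)"

definition dtime :: "'a spacetime \<Rightarrow> 'a chart \<Rightarrow> real^4 \<Rightarrow> real^4 \<Rightarrow> real" where
  "dtime M c y v = (\<Sum>a\<in>UNIV. pd a (in_chart c (time_fn M)) y * v $ a)"

definition future_causal :: "'a spacetime \<Rightarrow> 'a chart \<Rightarrow> real^4 \<Rightarrow> real^4 \<Rightarrow> bool" where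
  "future_causal M c y v \<longleftrightarrow> v \<noteq> 0 \<and> v \<bullet> (metric M c y *v v) \<le> 0 \<and> dtime M c y v > 0"

text \<open>Piecewise \<open>C\<^sup>1\<close> curves, with locally finitely many break points in the interval \<open>I\<close>.\<close>

definition future_causal_curve ::
  "'a::topological_space spacetime \<Rightarrow> (real \<Rightarrow> 'a) \<Rightarrow> real set \<Rightarrow> bool" where
  "future_causal_curve M \<gamma> I \<longleftrightarrow> continuous_on I \<gamma> \<and>
     (\<exists>S. (\<forall>a\<in>I. \<forall>b\<in>I. finite (S \<inter> {a..b})) \<and>
       (\<forall>c\<in>atlas M. let J = {s \<in> interior I - S. \<gamma> s \<in> dom_of c} in
          (snd c \<circ> \<gamma>) C1_differentiable_on J \<and>
          (\<forall>s\<in>J. future_causal M c (snd c (\<gamma> s)) (vector_derivative (snd c \<circ> \<gamma>) (at s)))))"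

definition inextendible :: "(real \<Rightarrow> 'a::topological_space) \<Rightarrow> bool" where
  "inextendible \<gamma> \<longleftrightarrow> \<not> (\<exists>p. (\<gamma> \<longlongrightarrow> p) (at_right 0)) \<and> \<not> (\<exists>p. (\<gamma> \<longlongrightarrow> p) (at_left 1))"

text \<open>Inextendible curves are parametrized by the open unit interval.\<close>

definition cauchy_surface :: "'a::topological_space spacetime \<Rightarrow> 'a set \<Rightarrow> bool" where
  "cauchy_surface M \<Sigma> \<longleftrightarrow>
     (\<forall>\<gamma>. future_causal_curve M \<gamma> {0<..<1} \<and> inextendible \<gamma> \<longrightarrow> (\<exists>!s. s \<in> {0<..<1} \<and> \<gamma> s \<in> \<Sigma>))"

text \<open>The time function is smooth with timelike gradient, and its level sets are Cauchy surfaces.\<close>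

definition globally_hyperbolic :: "'a::topological_space spacetime \<Rightarrow> bool" where
  "globally_hyperbolic M \<longleftrightarrow>
     maximal_smooth_atlas (atlas M) \<and> lorentzian_metric M \<and> time_fn M \<in> smooth_functions M \<and>
     (\<forall>c\<in>atlas M. \<forall>y\<in>img_of c. let n = (\<chi> a. pd a (in_chart c (time_fn M)) y)
        in n \<bullet> (matrix_inv (metric M c y) *v n) < 0) \<and>
     (\<forall>s\<in>range (time_fn M). cauchy_surface M {p. time_fn M p = s})"

definition causal_future :: "'a::topological_space spacetime \<Rightarrow> 'a set \<Rightarrow> 'a set" where
  "causal_future M S = S \<union>
     {q. \<exists>p\<in>S. \<exists>\<gamma> a b. a < b \<and> future_causal_curve M \<gamma> {a..b} \<and> \<gamma> a = p \<and> \<gamma> b = q}"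

definition causal_past :: "'a::topological_space spacetime \<Rightarrow> 'a set \<Rightarrow> 'a set" where
  "causal_past M S = {q. causal_future M {q} \<inter> S \<noteq> {}}"

definition spacelike_separated :: "'a::topological_space spacetime \<Rightarrow> 'a set \<Rightarrow> 'a set \<Rightarrow> bool" where
  "spacelike_separated M S T \<longleftrightarrow> (causal_future M S \<union> causal_past M S) \<inter> T = {}"

definition volume :: "'a::topological_space spacetime \<Rightarrow> 'a measure" where
  "volume M = (THE \<nu>. sets \<nu> = sets borel \<and>
     (\<forall>c\<in>atlas M. \<forall>B\<in>sets borel. B \<subseteq> dom_of c \<longrightarrow>
        emeasure \<nu> B = (\<integral>\<^sup>+y\<in>snd c ` B. ennreal (sqrt (- det (metric M c y))) \<partial>lborel)))"

section \<open>The Klein-Gordon field\<close>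

definition christoffel :: "'a spacetime \<Rightarrow> 'a chart \<Rightarrow> 4 \<Rightarrow> 4 \<Rightarrow> 4 \<Rightarrow> real^4 \<Rightarrow> real" where
  "christoffel M c a b d y = (\<Sum>e\<in>UNIV. matrix_inv (metric M c y) $ a $ e *
     (pd b (\<lambda>z. metric M c z $ e $ d) y + pd d (\<lambda>z. metric M c z $ b $ e) y
      - pd e (\<lambda>z. metric M c z $ b $ d) y)) / 2"

definition ricci :: "'a spacetime \<Rightarrow> 'a chart \<Rightarrow> 4 \<Rightarrow> 4 \<Rightarrow> real^4 \<Rightarrow> real" where
  "ricci M c b d y = (\<Sum>a\<in>UNIV. pd a (christoffel M c a b d) y - pd d (christoffel M c a b a) y
     + (\<Sum>e\<in>UNIV. christoffel M c a a e y * christoffel M c e b d y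
               - christoffel M c a d e y * christoffel M c e b a y))"

definition ricci_scalar :: "'a spacetime \<Rightarrow> 'a chart \<Rightarrow> real^4 \<Rightarrow> real" where
  "ricci_scalar M c y = (\<Sum>b\<in>UNIV. \<Sum>d\<in>UNIV. matrix_inv (metric M c y) $ b $ d * ricci M c b d y)"

definition box_op :: "'a spacetime \<Rightarrow> 'a chart \<Rightarrow> (real^4 \<Rightarrow> real) \<Rightarrow> real^4 \<Rightarrow> real" where
  "box_op M c u y = (\<Sum>a\<in>UNIV. \<Sum>b\<in>UNIV. matrix_inv (metric M c y) $ a $ b *
     (pd a (pd b u) y - (\<Sum>d\<in>UNIV. christoffel M c d a b y * pd d u y)))"

text \<open>On a Lorentzian manifold the value does not depend on the selected chart.\<close>

definition klein_gordon :: "'a spacetime \<Rightarrow> real \<Rightarrow> real \<Rightarrow> ('a \<Rightarrow> real) \<Rightarrow> 'a \<Rightarrow> real" where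
  "klein_gordon M m \<xi> h p =
     (let c = (SOME c. c \<in> atlas M \<and> p \<in> dom_of c); y = snd c p
      in box_op M c (in_chart c h) y - m\<^sup>2 * h p - \<xi> * ricci_scalar M c y * h p)"

definition green_operator ::
  "'a::topological_space spacetime \<Rightarrow> real \<Rightarrow> real \<Rightarrow> ('a set \<Rightarrow> 'a set) \<Rightarrow>
   (('a \<Rightarrow> real) \<Rightarrow> 'a \<Rightarrow> real) \<Rightarrow> bool" where
  "green_operator M m \<xi> J G \<longleftrightarrow>
     (\<forall>f\<in>test_functions M. \<forall>g\<in>test_functions M. \<forall>r. G (\<lambda>x. r * f x + g x) = (\<lambda>x. r * G f x + G g x)) \<and>
     (\<forall>f\<in>test_functions M. G f \<in> smooth_functions M \<and> klein_gordon M m \<xi> (G f) = f \<and>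
        G (klein_gordon M m \<xi> f) = f \<and> supp (G f) \<subseteq> J (supp f))"

definition retarded_propagator ::
  "'a::topological_space spacetime \<Rightarrow> real \<Rightarrow> real \<Rightarrow> (('a \<Rightarrow> real) \<Rightarrow> 'a \<Rightarrow> real) \<Rightarrow> bool" where
  "retarded_propagator M m \<xi> G \<longleftrightarrow> green_operator M m \<xi> (causal_future M) G"

definition advanced_propagator ::
  "'a::topological_space spacetime \<Rightarrow> real \<Rightarrow> real \<Rightarrow> (('a \<Rightarrow> real) \<Rightarrow> 'a \<Rightarrow> real) \<Rightarrow> bool" where
  "advanced_propagator M m \<xi> G \<longleftrightarrow> green_operator M m \<xi> (causal_past M) G"

definition causal_propagator ::
  "(('a \<Rightarrow> real) \<Rightarrow> 'a \<Rightarrow> real) \<Rightarrow> (('a \<Rightarrow> real) \<Rightarrow> 'a \<Rightarrow> real) \<Rightarrow> ('a \<Rightarrow> real) \<Rightarrow> 'a \<Rightarrow> real" where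
  "causal_propagator Eret Eadv f = (\<lambda>x. Eadv f x - Eret f x)"

section \<open>Distributional smearings\<close>

text \<open>Smearings are compactly supported distributions, acting on smooth functions. A function \<open>f\<close>
  is identified with \<open>h \<mapsto> \<integral> f h dV\<close>.\<close>

type_synonym 'a distribution = "('a \<Rightarrow> real) \<Rightarrow> real"

definition dist_of :: "'a::topological_space spacetime \<Rightarrow> ('a \<Rightarrow> real) \<Rightarrow> 'a distribution" where
  "dist_of M f = (\<lambda>h. \<integral>x. f x * h x \<partial>volume M)"

text \<open>Continuity is expressed by a bound in terms of finitely many derivatives on a finite union of
  compact sets, each contained in a chart domain.\<close>

definition compact_distribution :: "'a::topological_space spacetime \<Rightarrow> 'a distribution \<Rightarrow> bool" where
  "compact_distribution M T \<longleftrightarrow>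
     (\<forall>h\<in>smooth_functions M. \<forall>k\<in>smooth_functions M. \<forall>r. T (\<lambda>x. r * h x + k x) = r * T h + T k) \<and>
     (\<exists>Q n C. finite Q \<and> (\<forall>(c, K)\<in>Q. c \<in> atlas M \<and> compact K \<and> K \<subseteq> dom_of c) \<and>
        (\<forall>h\<in>smooth_functions M. \<forall>b\<ge>0.
           (\<forall>(c, K)\<in>Q. \<forall>p\<in>K. \<forall>is. length is \<le> n \<longrightarrow> \<bar>foldr pd is (in_chart c h) (snd c p)\<bar> \<le> b)
           \<longrightarrow> \<bar>T h\<bar> \<le> C * b))"

definition dist_supp :: "'a::topological_space spacetime \<Rightarrow> 'a distribution \<Rightarrow> 'a set" where
  "dist_supp M T = - \<Union>{N. open N \<and> (\<forall>h\<in>test_functions M. supp h \<subseteq> N \<longrightarrow> T h = 0)}"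

text \<open>The distributional solution \<open>E f\<close>, as a functional on test functions:
  \<open>\<integral> h (E f) dV = E(h, f) = - E(f, h) = - \<integral> f (E h) dV\<close>.\<close>

definition prop_dist ::
  "'a::topological_space spacetime \<Rightarrow> (('a \<Rightarrow> real) \<Rightarrow> 'a \<Rightarrow> real) \<Rightarrow> 'a distribution \<Rightarrow> 'a distribution" where
  "prop_dist M E f = (\<lambda>h. if h \<in> test_functions M then - f (E h) else 0)"

text \<open>A class \<open>\<F>\<close> of smearings containing the test functions, to which the bilinear form
  \<open>E(f, g) = \<integral> f (E g) dV\<close> is extended together with its antisymmetry and causality property.\<close>

definition smearing_class ::
  "'a::topological_space spacetime \<Rightarrow> (('a \<Rightarrow> real) \<Rightarrow> 'a \<Rightarrow> real) \<Rightarrow> 'a distribution set \<Rightarrow>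
   ('a distribution \<Rightarrow> 'a distribution \<Rightarrow> real) \<Rightarrow> bool" where
  "smearing_class M E \<F> EE \<longleftrightarrow>
     (\<forall>f\<in>\<F>. compact_distribution M f) \<and> (\<forall>f\<in>test_functions M. dist_of M f \<in> \<F>) \<and>
     (\<forall>f\<in>\<F>. \<forall>g\<in>\<F>. \<forall>r. (\<lambda>h. r * f h + g h) \<in> \<F>) \<and>
     (\<forall>f\<in>\<F>. \<forall>k\<in>test_functions M. EE f (dist_of M k) = f (E k)) \<and>
     (\<forall>f\<in>\<F>. \<forall>g\<in>\<F>. \<forall>k\<in>\<F>. \<forall>r. EE (\<lambda>h. r * f h + g h) k = r * EE f k + EE g k) \<and>
     (\<forall>f\<in>\<F>. \<forall>g\<in>\<F>. EE f g = - EE g f) \<and>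
     (\<forall>f\<in>\<F>. \<forall>g\<in>\<F>. spacelike_separated M (dist_supp M f) (dist_supp M g) \<longrightarrow> EE f g = 0)"

section \<open>Complex Hilbert spaces and C*-algebras\<close>

class complex_vector = real_vector +
  fixes scaleC :: "complex \<Rightarrow> 'a \<Rightarrow> 'a" (infixr \<open>*\<^sub>C\<close> 75)
  assumes scaleC_add_right: "a *\<^sub>C (x + y) = a *\<^sub>C x + a *\<^sub>C y"
    and scaleC_add_left: "(a + b) *\<^sub>C x = a *\<^sub>C x + b *\<^sub>C x"
    and scaleC_scaleC: "a *\<^sub>C (b *\<^sub>C x) = (a * b) *\<^sub>C x"
    and scaleR_scaleC: "r *\<^sub>R x = complex_of_real r *\<^sub>C x"

class complex_hilbert = complex_vector + real_normed_vector + complete_space +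
  fixes cinner :: "'a \<Rightarrow> 'a \<Rightarrow> complex"
  assumes cinner_commute: "cinner x y = cnj (cinner y x)"
    and cinner_add_right: "cinner x (y + z) = cinner x y + cinner x z"
    and cinner_scaleC_right: "cinner x (a *\<^sub>C y) = a * cinner x y"
    and norm_eq_sqrt_cinner: "norm x = sqrt (Re (cinner x x))"

class unital_cstar_algebra = complex_vector + real_normed_algebra_1 + complete_space +
  fixes dagger :: "'a \<Rightarrow> 'a"
  assumes scaleC_mult_left: "(a *\<^sub>C x) * y = a *\<^sub>C (x * y)"
    and scaleC_mult_right: "x * (a *\<^sub>C y) = a *\<^sub>C (x * y)"
    and norm_scaleC: "norm (a *\<^sub>C x) = cmod a * norm x"
    and dagger_dagger: "dagger (dagger x) = x"
    and dagger_add: "dagger (x + y) = dagger x + dagger y"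
    and dagger_mult: "dagger (x * y) = dagger y * dagger x"
    and dagger_scaleC: "dagger (a *\<^sub>C x) = cnj a *\<^sub>C dagger x"
    and cstar_identity: "norm (dagger x * x) = (norm x)\<^sup>2"

instantiation complex :: complex_hilbert
begin
definition scaleC_complex :: "complex \<Rightarrow> complex \<Rightarrow> complex" where "scaleC_complex = (*)"
definition cinner_complex :: "complex \<Rightarrow> complex \<Rightarrow> complex" where "cinner_complex x y = cnj x * y"
instance
  by standard
    (auto simp: scaleC_complex_def cinner_complex_def algebra_simps scaleR_conv_of_real cmod_def
      power2_eq_square)
end

instantiation vec :: (complex_vector, finite) complex_vector
begin
definition scaleC_vec :: "complex \<Rightarrow> 'a^'b \<Rightarrow> 'a^'b" where "scaleC_vec a x = (\<chi> i. a *\<^sub>C (x $ i))"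
instance
  by standard
    (auto simp: scaleC_vec_def vec_eq_iff scaleC_add_right scaleC_add_left scaleC_scaleC
      scaleR_scaleC)
end

text \<open>The space \<open>'a^'b\<close> is the tensor product of \<open>\<complex>^'b\<close> with \<open>'a\<close>.\<close>

instantiation vec :: (complex_hilbert, finite) complex_hilbert
begin
definition cinner_vec :: "'a^'b \<Rightarrow> 'a^'b \<Rightarrow> complex" where
  "cinner_vec x y = (\<Sum>i\<in>UNIV. cinner (x $ i) (y $ i))"
instance
proof
  fix x y z :: "'a^'b" and a :: complex
  show "cinner x y = cnj (cinner y x)"
    by (simp add: cinner_vec_def) (metis cinner_commute)
  show "cinner x (y + z) = cinner x y + cinner x z"
    by (simp add: cinner_vec_def cinner_add_right sum.distrib)
  show "cinner x (a *\<^sub>C y) = a * cinner x y"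
    by (simp add: cinner_vec_def scaleC_vec_def cinner_scaleC_right sum_distrib_left)
  have "Re (cinner (x $ i) (x $ i)) = (norm (x $ i))\<^sup>2" for i
    by (metis norm_eq_sqrt_cinner norm_ge_zero real_sqrt_ge_0_iff real_sqrt_pow2)
  then show "norm x = sqrt (Re (cinner x x))"
    by (simp add: norm_vec_def L2_set_def cinner_vec_def)
qed
end

definition bounded_op :: "('h::complex_hilbert \<Rightarrow> 'h) \<Rightarrow> bool" where
  "bounded_op T \<longleftrightarrow> (\<forall>x y. T (x + y) = T x + T y) \<and> (\<forall>a x. T (a *\<^sub>C x) = a *\<^sub>C T x) \<and>
     (\<exists>K. \<forall>x. norm (T x) \<le> K * norm x)"

definition adjoint_op :: "('h::complex_hilbert \<Rightarrow> 'h) \<Rightarrow> 'h \<Rightarrow> 'h" where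
  "adjoint_op T = (THE S. \<forall>x y. cinner (S x) y = cinner x (T y))"

definition orthonormal_basis :: "'h::complex_hilbert set \<Rightarrow> bool" where
  "orthonormal_basis B \<longleftrightarrow> (\<forall>e\<in>B. \<forall>f\<in>B. cinner e f = (if e = f then 1 else 0)) \<and>
     (\<forall>x. (\<forall>e\<in>B. cinner e x = 0) \<longrightarrow> x = 0)"

text \<open>A bounded operator is trace class iff the diagonal sums converge unconditionally in every
  orthonormal basis; the sum is then the same for all bases.\<close>

definition has_op_trace :: "('h::complex_hilbert \<Rightarrow> 'h) \<Rightarrow> complex \<Rightarrow> bool" where
  "has_op_trace T z \<longleftrightarrow> (\<forall>B. orthonormal_basis B \<longrightarrow> ((\<lambda>e. cinner e (T e)) has_sum z) B)"

definition op_trace :: "('h::complex_hilbert \<Rightarrow> 'h) \<Rightarrow> complex" where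
  "op_trace T = (THE z. has_op_trace T z)"

definition density_operator :: "('h::complex_hilbert \<Rightarrow> 'h) \<Rightarrow> bool" where
  "density_operator \<rho> \<longleftrightarrow> bounded_op \<rho> \<and>
     (\<forall>x. Im (cinner x (\<rho> x)) = 0 \<and> Re (cinner x (\<rho> x)) \<ge> 0) \<and> has_op_trace \<rho> 1"

section \<open>Weyl algebra, quasifree states, representations\<close>

definition generated_cstar_subalgebra :: "'w::unital_cstar_algebra set \<Rightarrow> 'w set" where
  "generated_cstar_subalgebra S = \<Inter>{B. S \<subseteq> B \<and> closed B \<and> 1 \<in> B \<and>
     (\<forall>x\<in>B. \<forall>y\<in>B. x + y \<in> B \<and> x * y \<in> B) \<and> (\<forall>a. \<forall>x\<in>B. a *\<^sub>C x \<in> B) \<and> (\<forall>x\<in>B. dagger x \<in> B)}"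

text \<open>The whole type \<open>'w\<close> is the Weyl algebra; \<open>W\<close> takes solutions \<open>E f\<close> as arguments.\<close>

definition weyl_algebra ::
  "'a::topological_space spacetime \<Rightarrow> real \<Rightarrow> real \<Rightarrow> (('a \<Rightarrow> real) \<Rightarrow> 'a \<Rightarrow> real) \<Rightarrow>
   'a distribution set \<Rightarrow> ('a distribution \<Rightarrow> 'a distribution \<Rightarrow> real) \<Rightarrow>
   ('a distribution \<Rightarrow> 'w::unital_cstar_algebra) \<Rightarrow> bool" where
  "weyl_algebra M m \<xi> E \<F> EE W \<longleftrightarrow>
     generated_cstar_subalgebra (W ` prop_dist M E ` \<F>) = UNIV \<and>
     (\<forall>f\<in>\<F>. dagger (W (prop_dist M E f)) = W (\<lambda>h. - prop_dist M E f h)) \<and>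
     (\<forall>f\<in>test_functions M. W (prop_dist M E (dist_of M (klein_gordon M m \<xi> f))) = 1) \<and>
     (\<forall>f\<in>\<F>. \<forall>g\<in>\<F>. W (prop_dist M E f) * W (prop_dist M E g) =
        exp (- (\<i> / 2) * complex_of_real (EE f g)) *\<^sub>C W (prop_dist M E (\<lambda>h. f h + g h)))"

definition is_state :: "('w::unital_cstar_algebra \<Rightarrow> complex) \<Rightarrow> bool" where
  "is_state \<omega> \<longleftrightarrow> (\<forall>x y. \<omega> (x + y) = \<omega> x + \<omega> y) \<and> (\<forall>a x. \<omega> (a *\<^sub>C x) = a * \<omega> x) \<and>
     (\<forall>x. Im (\<omega> (dagger x * x)) = 0 \<and> Re (\<omega> (dagger x * x)) \<ge> 0) \<and> \<omega> 1 = 1"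

definition real_inner_product_on ::
  "'a distribution set \<Rightarrow> ('a distribution \<Rightarrow> 'a distribution \<Rightarrow> real) \<Rightarrow> bool" where
  "real_inner_product_on V \<mu> \<longleftrightarrow>
     (\<forall>u\<in>V. \<forall>v\<in>V. \<forall>w\<in>V. \<forall>r. \<mu> (\<lambda>h. r * u h + v h) w = r * \<mu> u w + \<mu> v w) \<and>
     (\<forall>u\<in>V. \<forall>v\<in>V. \<mu> u v = \<mu> v u) \<and> (\<forall>u\<in>V. u \<noteq> (\<lambda>h. 0) \<longrightarrow> \<mu> u u > 0)"

definition quasifree_state ::
  "'a::topological_space spacetime \<Rightarrow> (('a \<Rightarrow> real) \<Rightarrow> 'a \<Rightarrow> real) \<Rightarrow> 'a distribution set \<Rightarrow>
   ('a distribution \<Rightarrow> 'a distribution \<Rightarrow> real) \<Rightarrow> ('a distribution \<Rightarrow> 'w::unital_cstar_algebra) \<Rightarrow>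
   ('a distribution \<Rightarrow> 'a distribution \<Rightarrow> real) \<Rightarrow> ('w \<Rightarrow> complex) \<Rightarrow> bool" where
  "quasifree_state M E \<F> EE W \<mu> \<omega> \<longleftrightarrow> is_state \<omega> \<and>
     real_inner_product_on (prop_dist M E ` \<F>) \<mu> \<and>
     (\<forall>f\<in>\<F>. \<forall>g\<in>\<F>. \<bar>EE f g\<bar>\<^sup>2 \<le> 4 * \<mu> (prop_dist M E f) (prop_dist M E f) * \<mu> (prop_dist M E g) (prop_dist M E g)) \<and>
     (\<forall>f\<in>\<F>. \<omega> (W (prop_dist M E f)) = complex_of_real (exp (- \<mu> (prop_dist M E f) (prop_dist M E f) / 2)))"

definition wightman ::
  "'a::topological_space spacetime \<Rightarrow> (('a \<Rightarrow> real) \<Rightarrow> 'a \<Rightarrow> real) \<Rightarrow>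
   ('a distribution \<Rightarrow> 'a distribution \<Rightarrow> real) \<Rightarrow> ('a distribution \<Rightarrow> 'a distribution \<Rightarrow> real) \<Rightarrow>
   'a distribution \<Rightarrow> 'a distribution \<Rightarrow> complex" where
  "wightman M E EE \<mu> f g =
     complex_of_real (\<mu> (prop_dist M E f) (prop_dist M E g)) + (\<i> / 2) * complex_of_real (EE f g)"

definition representation :: "('w::unital_cstar_algebra \<Rightarrow> 'h::complex_hilbert \<Rightarrow> 'h) \<Rightarrow> bool" where
  "representation \<pi> \<longleftrightarrow> (\<forall>X. bounded_op (\<pi> X)) \<and> \<pi> 1 = id \<and>
     (\<forall>X Y. \<pi> (X + Y) = (\<lambda>x. \<pi> X x + \<pi> Y x)) \<and> (\<forall>a X. \<pi> (a *\<^sub>C X) = (\<lambda>x. a *\<^sub>C \<pi> X x)) \<and>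
     (\<forall>X Y. \<pi> (X * Y) = \<pi> X \<circ> \<pi> Y) \<and>
     (\<forall>X x y. cinner (\<pi> (dagger X) x) y = cinner x (\<pi> X y))"

definition represents_state ::
  "('w::unital_cstar_algebra \<Rightarrow> 'h::complex_hilbert \<Rightarrow> 'h) \<Rightarrow> ('h \<Rightarrow> 'h) \<Rightarrow> ('w \<Rightarrow> complex) \<Rightarrow> bool" where
  "represents_state \<pi> \<rho> \<omega> \<longleftrightarrow> density_operator \<rho> \<and> (\<forall>X. has_op_trace (\<rho> \<circ> \<pi> X) (\<omega> X))"

definition cos_field ::
  "'a::topological_space spacetime \<Rightarrow> (('a \<Rightarrow> real) \<Rightarrow> 'a \<Rightarrow> real) \<Rightarrow>
   ('a distribution \<Rightarrow> 'w::unital_cstar_algebra) \<Rightarrow> 'a distribution \<Rightarrow> 'w" where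
  "cos_field M E W f = (1 / 2) *\<^sub>C (W (prop_dist M E f) + W (\<lambda>h. - prop_dist M E f h))"

definition sin_field ::
  "'a::topological_space spacetime \<Rightarrow> (('a \<Rightarrow> real) \<Rightarrow> 'a \<Rightarrow> real) \<Rightarrow>
   ('a distribution \<Rightarrow> 'w::unital_cstar_algebra) \<Rightarrow> 'a distribution \<Rightarrow> 'w" where
  "sin_field M E W f = (1 / (2 * \<i>)) *\<^sub>C (W (prop_dist M E f) - W (\<lambda>h. - prop_dist M E f h))"

section \<open>Qubits\<close>

datatype level = Gnd | Exc

instance level :: finite
proof
  have "(UNIV :: level set) = {Gnd, Exc}"
    using level.exhaust by blast
  then show "finite (UNIV :: level set)"
    by (metis finite.emptyI finite_insert)
qed

type_synonym qubit_op = "complex^level^level"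

definition ketbra :: "level \<Rightarrow> level \<Rightarrow> qubit_op" where
  "ketbra i j = (\<chi> k l. if k = i \<and> l = j then 1 else 0)"

definition density_matrix :: "qubit_op \<Rightarrow> bool" where
  "density_matrix \<rho> \<longleftrightarrow> (\<forall>v. Im (cinner v (\<rho> *v v)) = 0 \<and> Re (cinner v (\<rho> *v v)) \<ge> 0) \<and> trace \<rho> = 1"

text \<open>The Hilbert space of qubit A, qubit B and the field, in this order, is \<open>'h^(level \<times> level)\<close>.\<close>

definition tensor_op ::
  "qubit_op \<Rightarrow> qubit_op \<Rightarrow> ('h::complex_hilbert \<Rightarrow> 'h) \<Rightarrow> 'h^(level \<times> level) \<Rightarrow> 'h^(level \<times> level)" where
  "tensor_op X Y Z \<Psi> = (\<chi> k. \<Sum>l\<in>UNIV. (X $ fst k $ fst l * Y $ snd k $ snd l) *\<^sub>C Z (\<Psi> $ l))"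

definition field_block ::
  "('h::complex_hilbert^(level \<times> level) \<Rightarrow> 'h^(level \<times> level)) \<Rightarrow>
   level \<times> level \<Rightarrow> level \<times> level \<Rightarrow> 'h \<Rightarrow> 'h" where
  "field_block T k l x = T (axis l x) $ k"

definition partial_trace_A_field ::
  "('h::complex_hilbert^(level \<times> level) \<Rightarrow> 'h^(level \<times> level)) \<Rightarrow> qubit_op" where
  "partial_trace_A_field T = (\<chi> b b'. \<Sum>a\<in>UNIV. op_trace (field_block T (a, b) (a, b')))"

section \<open>Delta-coupled detectors\<close>

text \<open>\<open>rest_coords\<close> are the local rest-frame coordinates \<open>(\<tau>, x\<^sub>1, x\<^sub>2, x\<^sub>3)\<close>.\<close>

record 'a detector =
  rest_coords :: "'a chart"
  energy_gap :: real
  coupling :: real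
  instant :: real
  profile :: "real^3 \<Rightarrow> real"

definition coord_vec :: "real \<Rightarrow> real^3 \<Rightarrow> real^4" where
  "coord_vec \<tau> x = vector [\<tau>, x $ 1, x $ 2, x $ 3]"

text \<open>The distribution \<open>\<lambda> \<eta> \<delta>(\<tau> - \<tau>\<^sub>0) F\<close>, integrated against \<open>dV = sqrt (- det g) d\<tau> d\<^sup>3x\<close>.\<close>

definition delta_smearing :: "'a spacetime \<Rightarrow> real \<Rightarrow> 'a detector \<Rightarrow> 'a distribution" where
  "delta_smearing M \<eta> D = (\<lambda>h. \<integral>x. (let y = coord_vec (instant D) x in
     coupling D * \<eta> * profile D x * in_chart (rest_coords D) h y
       * sqrt (- det (metric M (rest_coords D) y))) \<partial>lborel)"

text \<open>The time of the interaction, at the centre of mass.\<close>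

definition interaction_time :: "'a spacetime \<Rightarrow> 'a detector \<Rightarrow> real" where
  "interaction_time M D = in_chart (rest_coords D) (time_fn M) (coord_vec (instant D) 0)"

text \<open>Along the worldline \<open>x = 0\<close> the coordinate \<open>\<tau>\<close> is proper time and the spatial coordinate
  directions are orthogonal to the four-velocity.\<close>

definition rest_frame :: "'a::topological_space spacetime \<Rightarrow> 'a chart \<Rightarrow> bool" where
  "rest_frame M c \<longleftrightarrow> c \<in> atlas M \<and>
     (\<forall>\<tau>. coord_vec \<tau> 0 \<in> img_of c \<longrightarrow> (let y = coord_vec \<tau> 0 in
        metric M c y $ 1 $ 1 = -1 \<and> (\<forall>i. i \<noteq> 1 \<longrightarrow> metric M c y $ 1 $ i = 0) \<and>
        dtime M c y (axis 1 1) > 0))"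

definition static_delta_detector :: "'a::topological_space spacetime \<Rightarrow> 'a detector \<Rightarrow> bool" where
  "static_delta_detector M D \<longleftrightarrow>
     (let c = rest_coords D; y = coord_vec (instant D); K = closure {x. profile D x \<noteq> 0} in
      rest_frame M c \<and> y 0 \<in> img_of c \<and>
      integrable lborel (profile D) \<and> compact K \<and> y ` K \<subseteq> img_of c \<and>
      (\<forall>x\<in>K. in_chart c (time_fn M) (y x) = interaction_time M D))"

definition monopole :: "'a detector \<Rightarrow> qubit_op" where
  "monopole D = exp (\<i> * complex_of_real (energy_gap D * instant D)) *\<^sub>C ketbra Exc Gnd
     + exp (- \<i> * complex_of_real (energy_gap D * instant D)) *\<^sub>C ketbra Gnd Exc"

text \<open>\<open>exp (-i \<mu>\<^sub>j \<otimes> \<phi>(f\<^sub>j))\<close>, written out by \<open>\<mu>\<^sub>j\<^sup>2 = 1\<close> as \<open>1 \<otimes> cos \<phi>(f\<^sub>j) - i \<mu>\<^sub>j \<otimes> sin \<phi>(f\<^sub>j)\<close>, since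
  the Weyl algebra contains \<open>exp (i \<phi>(f\<^sub>j))\<close> but not the unbounded operator \<open>\<phi>(f\<^sub>j)\<close>.\<close>

definition U_A ::
  "'a::topological_space spacetime \<Rightarrow> (('a \<Rightarrow> real) \<Rightarrow> 'a \<Rightarrow> real) \<Rightarrow>
   ('a distribution \<Rightarrow> 'w::unital_cstar_algebra) \<Rightarrow> ('w \<Rightarrow> 'h::complex_hilbert \<Rightarrow> 'h) \<Rightarrow> real \<Rightarrow>
   'a detector \<Rightarrow> 'h^(level \<times> level) \<Rightarrow> 'h^(level \<times> level)" where
  "U_A M E W \<pi> \<eta> A \<Psi> =
     tensor_op (mat 1) (mat 1) (\<pi> (cos_field M E W (delta_smearing M \<eta> A))) \<Psi>
     - \<i> *\<^sub>C tensor_op (monopole A) (mat 1) (\<pi> (sin_field M E W (delta_smearing M \<eta> A))) \<Psi>"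

definition U_B ::
  "'a::topological_space spacetime \<Rightarrow> (('a \<Rightarrow> real) \<Rightarrow> 'a \<Rightarrow> real) \<Rightarrow>
   ('a distribution \<Rightarrow> 'w::unital_cstar_algebra) \<Rightarrow> ('w \<Rightarrow> 'h::complex_hilbert \<Rightarrow> 'h) \<Rightarrow> real \<Rightarrow>
   'a detector \<Rightarrow> 'h^(level \<times> level) \<Rightarrow> 'h^(level \<times> level)" where
  "U_B M E W \<pi> \<eta> B \<Psi> =
     tensor_op (mat 1) (mat 1) (\<pi> (cos_field M E W (delta_smearing M \<eta> B))) \<Psi>
     - \<i> *\<^sub>C tensor_op (mat 1) (monopole B) (\<pi> (sin_field M E W (delta_smearing M \<eta> B))) \<Psi>"

definition detector_channel ::
  "'a::topological_space spacetime \<Rightarrow> (('a \<Rightarrow> real) \<Rightarrow> 'a \<Rightarrow> real) \<Rightarrow>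
   ('a distribution \<Rightarrow> 'w::unital_cstar_algebra) \<Rightarrow> ('w \<Rightarrow> 'h::complex_hilbert \<Rightarrow> 'h) \<Rightarrow> ('h \<Rightarrow> 'h) \<Rightarrow>
   real \<Rightarrow> 'a detector \<Rightarrow> 'a detector \<Rightarrow> qubit_op \<Rightarrow> qubit_op" where
  "detector_channel M E W \<pi> \<rho>\<phi> \<eta> A B \<rho>B =
     (let U = U_B M E W \<pi> \<eta> B \<circ> U_A M E W \<pi> \<eta> A
      in partial_trace_A_field (U \<circ> tensor_op (ketbra Exc Exc) \<rho>B \<rho>\<phi> \<circ> adjoint_op U))"

text \<open>The excitation probability is defined with the square of the matrix element.\<close>

definition excitation_prob :: "qubit_op \<Rightarrow> real" where
  "excitation_prob \<sigma> = (cmod (\<sigma> $ Exc $ Exc))\<^sup>2"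

definition detector_pair ::
  "'a::topological_space spacetime \<Rightarrow> 'a distribution set \<Rightarrow> real \<Rightarrow> 'a detector \<Rightarrow> 'a detector \<Rightarrow> bool" where
  "detector_pair M \<F> \<eta> A B \<longleftrightarrow> static_delta_detector M A \<and> static_delta_detector M B \<and>
     delta_smearing M \<eta> A \<in> \<F> \<and> delta_smearing M \<eta> B \<in> \<F> \<and>
     interaction_time M A < interaction_time M B"

end

theory Submission
  imports Defs
begin

text \<open>Because \<open>E(f\<^sub>A, f\<^sub>B) = 0\<close>, the Weyl elements of the two detectors commute. The dependence on
  \<open>A\<close> then enters only through \<open>\<Sum>\<^sub>a K\<^sub>a\<^sup>\<dagger> K\<^sub>a = cos\<^sup>2 + sin\<^sup>2 = 1\<close>, where the \<open>K\<^sub>a\<close> are the field operators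
  that accompany the transitions of \<open>A\<close> from its excited state. What remains are the expectation
  values of \<open>cos\<^sup>2\<close>, \<open>sin\<^sup>2\<close> and \<open>sin cos\<close> of \<open>\<phi>(f\<^sub>B)\<close>; the last one vanishes, since a quasifree
  state takes the same value on \<open>W(2Ef\<^sub>B)\<close> and \<open>W(-2Ef\<^sub>B)\<close>.\<close>

section \<open>Sums over the levels of one and of two qubits\<close>

lemma UNIV_level: "(UNIV :: level set) = {Gnd, Exc}"
  using level.exhaust by blast

lemma sum_level: "sum f (UNIV :: level set) = f Gnd + f Exc"
  by (simp add: UNIV_level)

lemma sum_level_prod: "sum f (UNIV :: (level \<times> level) set) = (\<Sum>a\<in>UNIV. \<Sum>b\<in>UNIV. f (a, b))"
  by (simp add: sum.cartesian_product flip: UNIV_Times_UNIV)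

section \<open>Complex vector spaces and Hilbert spaces\<close>

lemma scaleC_one [simp]: "1 *\<^sub>C (x::'a::complex_vector) = x"
  using scaleR_scaleC[of 1 x] by simp

lemma scaleC_zero_left [simp]: "0 *\<^sub>C (x::'a::complex_vector) = 0"
  using scaleR_scaleC[of 0 x] by simp

lemma scaleC_zero_right [simp]: "a *\<^sub>C (0::'a::complex_vector) = 0"
  using scaleC_add_right[of a 0 "0::'a"] by simp

lemma scaleC_minus_left: "(- a) *\<^sub>C (x::'a::complex_vector) = - (a *\<^sub>C x)"
  using scaleC_add_left[of "-a" a x] by (simp add: eq_neg_iff_add_eq_0)

lemma scaleC_minus_right: "a *\<^sub>C (- x::'a::complex_vector) = - (a *\<^sub>C x)"
  using scaleC_add_right[of a "-x" x] by (simp add: eq_neg_iff_add_eq_0)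

lemma scaleC_diff_right: "a *\<^sub>C (x - y::'a::complex_vector) = a *\<^sub>C x - a *\<^sub>C y"
  using scaleC_add_right[of a x "-y"] by (simp add: scaleC_minus_right)

lemma scaleC_sum_right: "a *\<^sub>C (\<Sum>i\<in>I. f i :: 'a::complex_vector) = (\<Sum>i\<in>I. a *\<^sub>C f i)"
  by (induction I rule: infinite_finite_induct) (auto simp: scaleC_add_right)

lemma cinner_zero_right [simp]: "cinner x (0::'a::complex_hilbert) = 0"
  using cinner_scaleC_right[of x 0 0] by simp

lemma cinner_zero_left [simp]: "cinner (0::'a::complex_hilbert) x = 0"
  by (subst cinner_commute) simp

lemma cinner_sum_right: "cinner x (\<Sum>i\<in>I. f i :: 'a::complex_hilbert) = (\<Sum>i\<in>I. cinner x (f i))"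
  by (induction I rule: infinite_finite_induct) (auto simp: cinner_add_right)

lemma cinner_sum_left: "cinner (\<Sum>i\<in>I. f i :: 'a::complex_hilbert) x = (\<Sum>i\<in>I. cinner (f i) x)"
proof -
  have "cinner (\<Sum>i\<in>I. f i) x = cnj (\<Sum>i\<in>I. cinner x (f i))"
    by (subst cinner_commute) (simp add: cinner_sum_right)
  also have "\<dots> = (\<Sum>i\<in>I. cinner (f i) x)"
    unfolding cnj_sum by (rule sum.cong[OF refl]) (rule cinner_commute[symmetric])
  finally show ?thesis .
qed

lemma cinner_scaleC_left: "cinner (a *\<^sub>C x::'a::complex_hilbert) y = cnj a * cinner x y"
  by (metis cinner_commute cinner_scaleC_right complex_cnj_mult)

lemma cinner_diff_right: "cinner x (y - z::'a::complex_hilbert) = cinner x y - cinner x z"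
  using cinner_add_right[of x "y - z" z] by (simp add: algebra_simps)

lemma cinner_self: "cinner x x = complex_of_real ((norm (x::'a::complex_hilbert))\<^sup>2)"
proof -
  have "0 \<le> Re (cinner x x)"
    using norm_ge_zero[of x] unfolding norm_eq_sqrt_cinner real_sqrt_ge_0_iff .
  moreover have "Im (cinner x x) = 0"
    using arg_cong[OF cinner_commute[of x x], of Im] by simp
  ultimately show ?thesis
    by (simp add: complex_eq_iff norm_eq_sqrt_cinner)
qed

lemma cinner_self_eq_0 [simp]: "cinner x x = 0 \<longleftrightarrow> (x::'a::complex_hilbert) = 0"
  by (simp add: cinner_self)

text \<open>Nondegeneracy of the inner product; this is what makes adjoints unique.\<close>

lemma cinner_ext:
  assumes "\<And>z. cinner z x = cinner z (y::'a::complex_hilbert)"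
  shows "x = y"
proof -
  have "cinner (x - y) (x - y) = 0"
    by (simp add: cinner_diff_right assms)
  then show ?thesis
    by simp
qed

text \<open>Zorn's lemma gives a maximal orthonormal set, since two vectors in the union of a chain
  already lie in a common member. A nonzero vector orthogonal to it could be normalised and added,
  against maximality.\<close>

lemma orthonormal_basis_exists: "\<exists>B. orthonormal_basis (B :: 'h::complex_hilbert set)"
proof -
  define ON where "ON = {B :: 'h set. \<forall>e\<in>B. \<forall>f\<in>B. cinner e f = (if e = f then 1 else 0)}"
  have "\<Union>\<C> \<in> ON" if "subset.chain ON \<C>" for \<C>
  proof -
    have sub: "\<C> \<subseteq> ON" and total: "\<And>X Y. X \<in> \<C> \<Longrightarrow> Y \<in> \<C> \<Longrightarrow> X \<subseteq> Y \<or> Y \<subseteq> X"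
      using that by (auto simp: subset.chain_def)
    have "cinner e f = (if e = f then 1 else 0)" if ef: "e \<in> \<Union>\<C>" "f \<in> \<Union>\<C>" for e f
    proof -
      obtain X Y where "X \<in> \<C>" "e \<in> X" "Y \<in> \<C>" "f \<in> Y"
        using ef by blast
      then obtain B where "B \<in> \<C>" "e \<in> B" "f \<in> B"
        using total[of X Y] by blast
      then show ?thesis
        using sub by (auto simp: ON_def)
    qed
    then show ?thesis
      by (simp add: ON_def)
  qed
  then obtain B where B: "B \<in> ON" and max: "\<And>X. X \<in> ON \<Longrightarrow> B \<subseteq> X \<Longrightarrow> X = B"
    using subset_Zorn'[of ON] by blast
  have "x = 0" if orth: "\<forall>e\<in>B. cinner e x = 0" for x
  proof (rule ccontr)
    assume "x \<noteq> 0"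
    define y where "y = complex_of_real (1 / norm x) *\<^sub>C x"
    have y: "cinner y y = 1"
      using \<open>x \<noteq> 0\<close>
      unfolding y_def cinner_scaleC_left cinner_scaleC_right
      by (simp add: cinner_self power2_eq_square)
    have ortho: "cinner e y = 0" if "e \<in> B" for e
      using that orth by (simp add: y_def cinner_scaleC_right)
    then have "cinner y e = 0" if "e \<in> B" for e
      using that by (subst cinner_commute) simp
    then have "insert y B \<in> ON"
      using B y ortho by (auto simp: ON_def)
    then have "y \<in> B"
      using max[of "insert y B"] by blast
    then show False
      using ortho y by fastforce
  qed
  then show ?thesis
    using B unfolding orthonormal_basis_def ON_def by blast
qed

section \<open>Traces\<close>

text \<open>\<open>has_op_trace\<close> quantifies over all orthonormal bases, so its value is
  unique only because some basis exists.\<close>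

lemma op_trace_eqI:
  assumes "has_op_trace T z"
  shows "op_trace T = z"
  unfolding op_trace_def
proof (rule the_equality)
  fix y
  assume y: "has_op_trace T y"
  obtain B :: "'a set" where "orthonormal_basis B"
    using orthonormal_basis_exists by blast
  then show "y = z"
    using assms y unfolding has_op_trace_def by (blast intro: has_sum_unique)
qed (fact assms)

lemma has_op_trace_zero: "has_op_trace (\<lambda>x. 0) 0"
  by (simp add: has_op_trace_def)

lemma has_op_trace_add:
  assumes "has_op_trace S y" "has_op_trace T z"
  shows "has_op_trace (\<lambda>x. S x + T x) (y + z)"
  using assms by (auto simp: has_op_trace_def cinner_add_right intro!: has_sum_add)

lemma has_op_trace_scaleC:
  assumes "has_op_trace T z"
  shows "has_op_trace (\<lambda>x. a *\<^sub>C T x) (a * z)"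
  using assms by (auto simp: has_op_trace_def cinner_scaleC_right intro!: has_sum_cmult_right)

lemma has_op_trace_sum:
  assumes "\<And>i. i \<in> I \<Longrightarrow> has_op_trace (T i) (z i)"
  shows "has_op_trace (\<lambda>x. \<Sum>i\<in>I. T i x) (\<Sum>i\<in>I. z i)"
  using assms
  by (induction I rule: infinite_finite_induct)
    (auto simp: has_op_trace_zero intro!: has_op_trace_add)

text \<open>Exhibiting \<open>S\<close> settles existence in the definite description, and
  \<open>cinner_ext\<close> settles uniqueness.\<close>

lemma adjoint_op_eqI:
  assumes "\<And>x y. cinner (S x) y = cinner x (T y)"
  shows "adjoint_op T = S"
  unfolding adjoint_op_def
proof (rule the_equality)
  fix R
  assume R: "\<forall>x y. cinner (R x) y = cinner x (T y)"
  show "R = S"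
  proof
    fix x
    show "R x = S x"
      by (rule cinner_ext) (metis R assms cinner_commute)
  qed
qed (use assms in blast)

section \<open>Unitary elements and cyclicity of the trace\<close>

lemma dagger_minus: "dagger (- x) = - dagger (x::'a::unital_cstar_algebra)"
  using dagger_scaleC[of "-1" x] by (simp add: scaleC_minus_left)

lemma dagger_diff: "dagger (x - y) = dagger x - dagger (y::'a::unital_cstar_algebra)"
  using dagger_add[of x "-y"] by (simp add: dagger_minus)

lemma
  assumes "is_state \<omega>"
  shows state_add: "\<omega> (X + Y) = \<omega> X + \<omega> Y"
    and state_scaleC: "\<omega> (a *\<^sub>C X) = a * \<omega> X"
    and state_one: "\<omega> 1 = 1"
  using assms by (simp_all add: is_state_def)

definition unitary :: "'w::unital_cstar_algebra \<Rightarrow> bool" where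
  "unitary V \<longleftrightarrow> dagger V * V = 1 \<and> V * dagger V = 1"

lemma unitary_dagger: "unitary V \<Longrightarrow> unitary (dagger V)"
  by (simp add: unitary_def dagger_dagger)

lemma unitary_cancel:
  assumes "unitary V"
  shows "dagger V * (V * x) = x" "V * (dagger V * x) = x"
  using assms by (simp_all add: unitary_def flip: mult.assoc)

text \<open>Multiply \<open>x * V = V * x\<close> by \<open>dagger V\<close> on both sides and
  cancel.\<close>

lemma commute_dagger_unitary:
  assumes "unitary V" "x * V = V * x"
  shows "x * dagger V = dagger V * x"
proof -
  have "dagger V * (x * V) * dagger V = dagger V * (V * x) * dagger V"
    by (simp add: assms(2))
  then show ?thesis
    using assms(1) by (simp add: mult.assoc unitary_def unitary_cancel[OF assms(1)])
qed

context
  fixes \<pi> :: "'w::unital_cstar_algebra \<Rightarrow> 'h::complex_hilbert \<Rightarrow> 'h"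
  assumes rep: "representation \<pi>"
begin

lemma rep_add: "\<pi> (X + Y) x = \<pi> X x + \<pi> Y x"
  and rep_scaleC: "\<pi> (a *\<^sub>C X) x = a *\<^sub>C \<pi> X x"
  and rep_mult: "\<pi> (X * Y) x = \<pi> X (\<pi> Y x)"
  and rep_one: "\<pi> 1 x = x"
  and rep_dagger: "cinner (\<pi> (dagger X) x) y = cinner x (\<pi> X y)"
  using rep by (simp_all add: representation_def)

lemma rep_arg_add: "\<pi> X (x + y) = \<pi> X x + \<pi> X y"
  and rep_arg_scaleC: "\<pi> X (a *\<^sub>C x) = a *\<^sub>C \<pi> X x"
  using rep by (simp_all add: representation_def bounded_op_def)

lemma rep_zero: "\<pi> 0 x = 0"
  using rep_scaleC[of 0 0 x] by simp

lemma rep_arg_zero: "\<pi> X 0 = 0"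
  using rep_arg_scaleC[of X 0 0] by simp

lemma rep_diff: "\<pi> (X - Y) x = \<pi> X x - \<pi> Y x"
  using rep_add[of "X - Y" Y x] by (simp add: algebra_simps)

lemma rep_sum: "\<pi> (\<Sum>i\<in>I. X i) x = (\<Sum>i\<in>I. \<pi> (X i) x)"
  by (induction I rule: infinite_finite_induct) (auto simp: rep_zero rep_add)

lemma rep_arg_sum: "\<pi> X (\<Sum>i\<in>I. x i) = (\<Sum>i\<in>I. \<pi> X (x i))"
  by (induction I rule: infinite_finite_induct) (auto simp: rep_arg_zero rep_arg_add)

lemma rep_unitary_cancel:
  assumes "unitary V"
  shows "\<pi> V (\<pi> (dagger V) x) = x" "\<pi> (dagger V) (\<pi> V x) = x"
  using assms by (simp_all add: unitary_def rep_one flip: rep_mult)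

text \<open>A unitary preserves inner products. For completeness, a vector orthogonal to the image
  is carried by \<open>dagger V\<close> to a vector orthogonal to \<open>B\<close>, hence to
  0.\<close>

lemma orthonormal_basis_unitary_image:
  assumes V: "unitary V" and B: "orthonormal_basis B"
  shows "orthonormal_basis (\<pi> V ` B)"
proof -
  have iso: "cinner (\<pi> V x) (\<pi> V y) = cinner x y" for x y
    by (simp add: rep_unitary_cancel[OF V] flip: rep_dagger[of V])
  have inj: "\<pi> V x = \<pi> V y \<longleftrightarrow> x = y" for x y
    by (metis V rep_unitary_cancel(2))
  have "x = 0" if "\<forall>e\<in>B. cinner (\<pi> V e) x = 0" for x
  proof -
    have "\<forall>e\<in>B. cinner e (\<pi> (dagger V) x) = 0"
      using that by (metis dagger_dagger rep_dagger)
    then have "\<pi> (dagger V) x = 0"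
      using B by (simp add: orthonormal_basis_def)
    then show "x = 0"
      by (metis V rep_arg_zero rep_unitary_cancel(1))
  qed
  then show ?thesis
    using B by (simp add: orthonormal_basis_def iso inj)
qed

text \<open>For a unitary factor, cyclicity of the trace is just a change of orthonormal basis.\<close>

lemma has_op_trace_unitary_cyclic:
  assumes V: "unitary V" and T: "has_op_trace (T \<circ> \<pi> V) z"
  shows "has_op_trace (\<pi> V \<circ> T) z"
  unfolding has_op_trace_def
proof (intro allI impI)
  fix B :: "'h set"
  assume B: "orthonormal_basis B"
  let ?g = "\<pi> (dagger V)"
  have "inj_on ?g B"
    by (metis V inj_onI rep_unitary_cancel(1))
  moreover have "((\<lambda>e. cinner e ((T \<circ> \<pi> V) e)) has_sum z) (?g ` B)"
    using T orthonormal_basis_unitary_image[OF unitary_dagger[OF V] B]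
    by (simp add: has_op_trace_def)
  ultimately have "((\<lambda>e. cinner (?g e) (T (\<pi> V (?g e)))) has_sum z) B"
    by (simp add: has_sum_reindex o_def)
  then show "((\<lambda>e. cinner e ((\<pi> V \<circ> T) e)) has_sum z) B"
    by (simp add: rep_unitary_cancel[OF V] rep_dagger)
qed

section \<open>Operators given by matrices over the algebra\<close>

text \<open>A matrix over the algebra acts on the tensor product of a finite-dimensional space with
  the field space. Composition and adjoint of such operators become matrix operations over the
  algebra, so the total evolution can be computed there.\<close>

definition matrix_op :: "'w^'n^'n \<Rightarrow> 'h^'n \<Rightarrow> 'h^'n::finite" where
  "matrix_op u \<Psi> = (\<chi> k. \<Sum>l\<in>UNIV. \<pi> (u $ k $ l) (\<Psi> $ l))"

lemma matrix_op_comp: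
  fixes u v :: "'w^'n^'n"
  shows "matrix_op u \<circ> matrix_op v = matrix_op (u ** v)"
proof (rule ext)
  fix \<Psi> :: "'h^'n"
  have "matrix_op u (matrix_op v \<Psi>) $ k = matrix_op (u ** v) \<Psi> $ k" for k
  proof -
    have "matrix_op u (matrix_op v \<Psi>) $ k
        = (\<Sum>m\<in>UNIV. \<Sum>l\<in>UNIV. \<pi> (u $ k $ m) (\<pi> (v $ m $ l) (\<Psi> $ l)))"
      by (simp add: matrix_op_def rep_arg_sum)
    also have "\<dots> = (\<Sum>l\<in>UNIV. \<Sum>m\<in>UNIV. \<pi> (u $ k $ m) (\<pi> (v $ m $ l) (\<Psi> $ l)))"
      by (rule sum.swap)
    finally show ?thesis
      by (simp add: matrix_op_def matrix_matrix_mult_def rep_sum rep_mult)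
  qed
  then show "(matrix_op u \<circ> matrix_op v) \<Psi> = matrix_op (u ** v) \<Psi>"
    by (simp add: vec_eq_iff)
qed

lemma adjoint_matrix_op:
  fixes u :: "'w^'n^'n"
  shows "adjoint_op (matrix_op u) = matrix_op (\<chi> k l. dagger (u $ l $ k))"
proof (rule adjoint_op_eqI)
  fix x y :: "'h^'n"
  have "cinner (matrix_op (\<chi> k l. dagger (u $ l $ k)) x) y
      = (\<Sum>i\<in>UNIV. \<Sum>l\<in>UNIV. cinner (x $ l) (\<pi> (u $ l $ i) (y $ i)))"
    by (simp add: cinner_vec_def matrix_op_def cinner_sum_left rep_dagger)
  also have "\<dots> = (\<Sum>l\<in>UNIV. \<Sum>i\<in>UNIV. cinner (x $ l) (\<pi> (u $ l $ i) (y $ i)))"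
    by (rule sum.swap)
  finally show "cinner (matrix_op (\<chi> k l. dagger (u $ l $ k)) x) y = cinner x (matrix_op u y)"
    by (simp add: cinner_vec_def matrix_op_def cinner_sum_right)
qed

lemma matrix_op_axis: "matrix_op u (axis l x) $ k = \<pi> (u $ k $ l) x"
proof -
  have "\<pi> (u $ k $ m) (axis l x $ m) = (if m = l then \<pi> (u $ k $ l) x else 0)" for m
    by (simp add: axis_def rep_arg_zero)
  then show ?thesis
    by (simp add: matrix_op_def)
qed

text \<open>The density operator \<open>\<rho>\<close> is not given as the image of an algebra
  element, so it stays as an explicit middle factor in each term.\<close>

lemma field_block_sandwich:
  "field_block (matrix_op u \<circ> tensor_op X Y \<rho> \<circ> matrix_op v) k k' x =
     (\<Sum>l\<in>UNIV. \<Sum>l'\<in>UNIV. (X $ fst l $ fst l' * Y $ snd l $ snd l') *\<^sub>C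
        (\<pi> (u $ k $ l) \<circ> \<rho> \<circ> \<pi> (v $ l' $ k')) x)"
  by (simp add: field_block_def matrix_op_def[of u] tensor_op_def matrix_op_axis rep_arg_sum
      rep_arg_scaleC)

section \<open>Cyclicity of the trace against the field state, and the partial trace\<close>

context
  fixes \<rho> :: "'h \<Rightarrow> 'h" and \<omega> :: "'w \<Rightarrow> complex"
  assumes rho: "represents_state \<pi> \<rho> \<omega>"
begin

text \<open>Closure under sums, scalars and unitary left factors puts all entries of \<open>U\<close> into this set.\<close>

definition cyclic_elements :: "'w set" where
  "cyclic_elements = {X. \<forall>Y. has_op_trace (\<pi> X \<circ> \<rho> \<circ> \<pi> Y) (\<omega> (Y * X))}"

context
  assumes state: "is_state \<omega>"
begin

text \<open>The base case is precisely the trace formula in \<open>represents_state\<close>.\<close>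

lemma one_cyclic: "1 \<in> cyclic_elements"
  using rho by (simp add: cyclic_elements_def represents_state_def o_def rep_one)

lemma add_cyclic:
  assumes "X \<in> cyclic_elements" "X' \<in> cyclic_elements"
  shows "X + X' \<in> cyclic_elements"
  using assms has_op_trace_add
  by (fastforce simp: cyclic_elements_def o_def rep_add state_add[OF state] distrib_left)

lemma scaleC_cyclic:
  assumes "X \<in> cyclic_elements"
  shows "a *\<^sub>C X \<in> cyclic_elements"
  using assms has_op_trace_scaleC
  by (fastforce simp: cyclic_elements_def o_def rep_scaleC scaleC_mult_right state_scaleC[OF state])

text \<open>Use the property of \<open>X\<close> with \<open>Y * V\<close> in place of
  \<open>Y\<close>: the factor \<open>\<pi> V\<close> then stands at the far right, and cyclicity
  for unitaries brings it to the far left.\<close>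

lemma unitary_mult_cyclic:
  assumes V: "unitary V" and X: "X \<in> cyclic_elements"
  shows "V * X \<in> cyclic_elements"
proof -
  have "has_op_trace (\<pi> (V * X) \<circ> \<rho> \<circ> \<pi> Y) (\<omega> (Y * (V * X)))" for Y
  proof -
    have "has_op_trace ((\<pi> X \<circ> \<rho> \<circ> \<pi> Y) \<circ> \<pi> V) (\<omega> (Y * V * X))"
      using X by (simp add: cyclic_elements_def o_def flip: rep_mult)
    from has_op_trace_unitary_cyclic[OF V this] show ?thesis
      by (simp add: o_def rep_mult mult.assoc)
  qed
  then show ?thesis
    by (simp add: cyclic_elements_def)
qed

text \<open>Each block is a finite sum of terms in which \<open>\<rho>\<close> stands between two
  algebra elements. Cyclicity puts the adjoint factor, which comes from the right of
  \<open>\<rho>\<close>, first under \<open>\<omega>\<close>.\<close>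

lemma partial_trace_sandwich:
  assumes u: "\<And>k l. u $ k $ l \<in> cyclic_elements"
  shows "partial_trace_A_field (matrix_op u \<circ> tensor_op X Y \<rho> \<circ> adjoint_op (matrix_op u)) $ b $ b' =
    (\<Sum>a\<in>UNIV. \<Sum>l\<in>UNIV. \<Sum>l'\<in>UNIV. (X $ fst l $ fst l' * Y $ snd l $ snd l') *
       \<omega> (dagger (u $ (a, b') $ l') * u $ (a, b) $ l))"
proof -
  have "has_op_trace (field_block (matrix_op u \<circ> tensor_op X Y \<rho> \<circ> adjoint_op (matrix_op u)) k k')
      (\<Sum>l\<in>UNIV. \<Sum>l'\<in>UNIV. (X $ fst l $ fst l' * Y $ snd l $ snd l') *
       \<omega> (dagger (u $ k' $ l') * u $ k $ l))" for k k'
  proof -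
    have "has_op_trace (\<lambda>x. \<Sum>l\<in>UNIV. \<Sum>l'\<in>UNIV. (X $ fst l $ fst l' * Y $ snd l $ snd l') *\<^sub>C
        (\<pi> (u $ k $ l) \<circ> \<rho> \<circ> \<pi> (dagger (u $ k' $ l'))) x)
      (\<Sum>l\<in>UNIV. \<Sum>l'\<in>UNIV. (X $ fst l $ fst l' * Y $ snd l $ snd l') *
       \<omega> (dagger (u $ k' $ l') * u $ k $ l))"
      using u unfolding cyclic_elements_def
      by (intro has_op_trace_sum has_op_trace_scaleC) blast
    then show ?thesis
      unfolding adjoint_matrix_op field_block_sandwich[abs_def] by simp
  qed
  from op_trace_eqI[OF this] show ?thesis
    by (simp add: partial_trace_A_field_def)
qed

end
end
end
section \<open>Cosine and sine of a unitary\<close>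

text \<open>If \<open>V\<close> is read as the exponential of \<open>i\<close> times a field
  operator, this and \<open>unitary_sin\<close> are the cosine and sine of that operator.\<close>

definition unitary_cos :: "'w::unital_cstar_algebra \<Rightarrow> 'w" where
  "unitary_cos V = (1 / 2) *\<^sub>C (V + dagger V)"

definition unitary_sin :: "'w::unital_cstar_algebra \<Rightarrow> 'w" where
  "unitary_sin V = (1 / (2 * \<i>)) *\<^sub>C (V - dagger V)"

lemma dagger_unitary_cos: "dagger (unitary_cos V) = unitary_cos V"
  by (simp add: unitary_cos_def dagger_scaleC dagger_add dagger_dagger add.commute)

lemma dagger_unitary_sin: "dagger (unitary_sin V) = unitary_sin V"
proof -
  have "dagger (unitary_sin V) = (- (1 / (2 * \<i>))) *\<^sub>C (dagger V - V)"
    by (simp add: unitary_sin_def dagger_scaleC dagger_diff dagger_dagger)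
  also have "\<dots> = unitary_sin V"
    unfolding unitary_sin_def scaleC_minus_left by (simp add: scaleC_diff_right)
  finally show ?thesis .
qed

lemma commute_unitary_cos:
  assumes "x * V = V * x" "x * dagger V = dagger V * x"
  shows "x * unitary_cos V = unitary_cos V * x"
  by (simp add: unitary_cos_def scaleC_mult_left scaleC_mult_right assms algebra_simps)

lemma commute_unitary_sin:
  assumes "x * V = V * x" "x * dagger V = dagger V * x"
  shows "x * unitary_sin V = unitary_sin V * x"
  by (simp add: unitary_sin_def scaleC_mult_left scaleC_mult_right assms algebra_simps)

text \<open>These are the double-angle formulas, with \<open>V * V\<close> as the exponential of the
  doubled angle.\<close>

lemma unitary_cos_sin_products:
  assumes "unitary V"
  shows "unitary_cos V * unitary_cos V = (1 / 4) *\<^sub>C (V * V + dagger V * dagger V) + (1 / 2) *\<^sub>C 1"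
    and "unitary_sin V * unitary_sin V = (1 / 2) *\<^sub>C 1 - (1 / 4) *\<^sub>C (V * V + dagger V * dagger V)"
    and "unitary_sin V * unitary_cos V = (1 / (4 * \<i>)) *\<^sub>C (V * V - dagger V * dagger V)"
    and "unitary_cos V * unitary_sin V = (1 / (4 * \<i>)) *\<^sub>C (V * V - dagger V * dagger V)"
proof -
  have V: "V * dagger V = 1" "dagger V * V = 1"
    using assms by (simp_all add: unitary_def)
  \<comment> \<open>The mixed products of \<open>V\<close> and \<open>dagger V\<close> each
    contribute a quarter of the unit.\<close>
  have half: "(1 / 4) *\<^sub>C (1::'a) + (1 / 4) *\<^sub>C 1 = (1 / 2) *\<^sub>C 1"
    by (simp flip: scaleC_add_left)
  have "unitary_cos V * unitary_cos V
      = (1 / 4) *\<^sub>C (V * V + dagger V * dagger V) + ((1 / 4) *\<^sub>C 1 + (1 / 4) *\<^sub>C 1)"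
    by (simp add: unitary_cos_def scaleC_mult_left scaleC_mult_right scaleC_scaleC
        scaleC_add_right V algebra_simps)
  then show "unitary_cos V * unitary_cos V = (1 / 4) *\<^sub>C (V * V + dagger V * dagger V) + (1 / 2) *\<^sub>C 1"
    by (simp only: half)
  have "unitary_sin V * unitary_sin V
      = ((1 / 4) *\<^sub>C 1 + (1 / 4) *\<^sub>C 1) - (1 / 4) *\<^sub>C (V * V + dagger V * dagger V)"
    by (simp add: unitary_sin_def scaleC_mult_left scaleC_mult_right scaleC_scaleC
        scaleC_minus_left scaleC_add_right scaleC_diff_right V algebra_simps)
  then show "unitary_sin V * unitary_sin V = (1 / 2) *\<^sub>C 1 - (1 / 4) *\<^sub>C (V * V + dagger V * dagger V)"
    by (simp only: half)
  show "unitary_sin V * unitary_cos V = (1 / (4 * \<i>)) *\<^sub>C (V * V - dagger V * dagger V)"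
    "unitary_cos V * unitary_sin V = (1 / (4 * \<i>)) *\<^sub>C (V * V - dagger V * dagger V)"
    by (simp_all add: unitary_sin_def unitary_cos_def scaleC_mult_left scaleC_mult_right
        scaleC_scaleC scaleC_add_right scaleC_diff_right V algebra_simps)
qed

lemma unitary_cos_sq_plus_sin_sq:
  assumes "unitary V"
  shows "unitary_cos V * unitary_cos V + unitary_sin V * unitary_sin V = 1"
  by (simp add: unitary_cos_sin_products[OF assms] flip: scaleC_add_left)

text \<open>The mixed products are multiples of \<open>V * V - dagger V * dagger V\<close>, on which
  \<open>\<omega>\<close> vanishes because both squares have the value \<open>z\<close>.\<close>

lemma state_cos_sin_products:
  assumes state: "is_state \<omega>" and "unitary V"
    and "\<omega> (V * V) = z" "\<omega> (dagger V * dagger V) = z"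
  shows "\<omega> (unitary_cos V * unitary_cos V) = (1 + z) / 2"
    and "\<omega> (unitary_sin V * unitary_sin V) = (1 - z) / 2"
    and "\<omega> (unitary_sin V * unitary_cos V) = 0"
    and "\<omega> (unitary_cos V * unitary_sin V) = 0"
proof -
  have diff: "\<omega> (X - Y) = \<omega> X - \<omega> Y" for X Y
    using state_add[OF state, of "X - Y" Y] by simp
  show "\<omega> (unitary_cos V * unitary_cos V) = (1 + z) / 2"
    "\<omega> (unitary_sin V * unitary_sin V) = (1 - z) / 2"
    "\<omega> (unitary_sin V * unitary_cos V) = 0"
    "\<omega> (unitary_cos V * unitary_sin V) = 0"
    by (simp_all add: unitary_cos_sin_products assms diff state_add[OF state]
        state_scaleC[OF state] state_one[OF state] field_simps)
qed

section \<open>Two delta-coupled qubits\<close>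

text \<open>The matrix entry, between qubit levels \<open>i\<close> and \<open>j\<close>, of cosine
  minus \<open>\<i>\<close> times the monopole times sine. It is an element of the algebra.\<close>

definition kick :: "qubit_op \<Rightarrow> 'w::unital_cstar_algebra \<Rightarrow> level \<Rightarrow> level \<Rightarrow> 'w" where
  "kick \<mu> V i j =
     (if i = j then 1 else 0) *\<^sub>C unitary_cos V - (\<i> * \<mu> $ i $ j) *\<^sub>C unitary_sin V"

definition kick_A :: "qubit_op \<Rightarrow> 'w::unital_cstar_algebra \<Rightarrow> 'w^(level \<times> level)^(level \<times> level)" where
  "kick_A \<mu> V = (\<chi> k l. (if snd k = snd l then 1 else 0) *\<^sub>C kick \<mu> V (fst k) (fst l))"

definition kick_B :: "qubit_op \<Rightarrow> 'w::unital_cstar_algebra \<Rightarrow> 'w^(level \<times> level)^(level \<times> level)" where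
  "kick_B \<mu> V = (\<chi> k l. (if fst k = fst l then 1 else 0) *\<^sub>C kick \<mu> V (snd k) (snd l))"

text \<open>Each kick leaves the other qubit alone, so only the intermediate level pair
  \<open>(fst k, snd l)\<close> contributes to the matrix product.\<close>

lemma kick_B_kick_A: "(kick_B \<mu> V ** kick_A \<nu> U) $ k $ l = kick \<mu> V (snd k) (snd l) * kick \<nu> U (fst k) (fst l)"
  by (cases "fst k"; cases "snd l")
    (simp_all add: matrix_matrix_mult_def kick_A_def kick_B_def sum_level_prod sum_level)

lemma dagger_kick:
  "dagger (kick \<mu> V i j) =
     (if i = j then 1 else 0) *\<^sub>C unitary_cos V + (\<i> * cnj (\<mu> $ i $ j)) *\<^sub>C unitary_sin V"
  by (simp add: kick_def dagger_diff dagger_scaleC dagger_unitary_cos dagger_unitary_sin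
      scaleC_minus_left)

lemma monopole_entries:
  "monopole D $ Gnd $ Gnd = 0" "monopole D $ Exc $ Exc = 0"
  "monopole D $ Exc $ Gnd = cis (energy_gap D * instant D)"
  "monopole D $ Gnd $ Exc = cnj (cis (energy_gap D * instant D))"
  by (simp_all add: monopole_def ketbra_def scaleC_vec_def scaleC_complex_def cis_conv_exp exp_cnj)

text \<open>The monopole has zero diagonal: from the excited level, staying gives pure cosine and
  flipping gives pure sine up to a phase. No mixed products arise, and the sum is cosine squared
  plus sine squared.\<close>

lemma sum_dagger_kick_monopole:
  assumes "unitary V"
  shows "(\<Sum>a\<in>UNIV. dagger (kick (monopole D) V a Exc) * kick (monopole D) V a Exc) = 1"
proof -
  define \<theta> where "\<theta> = energy_gap D * instant D"
  \<comment> \<open>The phases of the monopole cancel, which makes the coefficient of sine squared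
    equal to 1.\<close>
  have "\<i> * (cnj (cis \<theta>) * (\<i> * cis \<theta>)) = - 1"
    by (simp add: cis_cnj cis_mult algebra_simps)
  then show ?thesis
    unfolding dagger_kick
    by (simp add: sum_level kick_def monopole_entries scaleC_mult_left scaleC_mult_right
        scaleC_scaleC scaleC_minus_left mult.assoc flip: \<theta>_def unitary_cos_sq_plus_sin_sq[OF assms])
qed

lemma commute_kick:
  assumes "x * V = V * x" "x * dagger V = dagger V * x"
  shows "x * kick \<mu> V i j = kick \<mu> V i j * x"
    and "x * dagger (kick \<mu> V i j) = dagger (kick \<mu> V i j) * x"
  unfolding dagger_kick
  by (simp_all add: kick_def scaleC_mult_left scaleC_mult_right algebra_simps
      commute_unitary_cos[OF assms] commute_unitary_sin[OF assms])

lemma state_dagger_kick_kick: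
  assumes state: "is_state \<omega>" and V: "unitary V"
    and z: "\<omega> (V * V) = z" "\<omega> (dagger V * dagger V) = z"
  shows "\<omega> (dagger (kick \<mu> V i' j') * kick \<mu> V i j) =
    (if i' = j' \<and> i = j then 1 else 0) * (1 + z) / 2 + cnj (\<mu> $ i' $ j') * \<mu> $ i $ j * (1 - z) / 2"
proof -
  have "dagger (kick \<mu> V i' j') * kick \<mu> V i j =
      (if i' = j' \<and> i = j then 1 else 0) *\<^sub>C (unitary_cos V * unitary_cos V)
      + (cnj (\<mu> $ i' $ j') * \<mu> $ i $ j) *\<^sub>C (unitary_sin V * unitary_sin V)
      + (if i = j then \<i> * cnj (\<mu> $ i' $ j') else 0) *\<^sub>C (unitary_sin V * unitary_cos V)
      + (if i' = j' then - \<i> * \<mu> $ i $ j else 0) *\<^sub>C (unitary_cos V * unitary_sin V)"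
    unfolding dagger_kick
    by (simp add: kick_def scaleC_mult_left scaleC_mult_right scaleC_scaleC scaleC_minus_left
        scaleC_add_right scaleC_diff_right algebra_simps)
  then show ?thesis
    by (simp add: state_add[OF state] state_scaleC[OF state] state_cos_sin_products[OF state V z])
qed

lemma matrix_op_kick_A:
  assumes "representation \<pi>"
  shows "matrix_op \<pi> (kick_A \<mu> V) \<Psi> = tensor_op (mat 1) (mat 1) (\<pi> (unitary_cos V)) \<Psi>
     - \<i> *\<^sub>C tensor_op \<mu> (mat 1) (\<pi> (unitary_sin V)) \<Psi>"
proof -
  have "\<pi> (kick_A \<mu> V $ k $ l) x =
      (mat 1 $ fst k $ fst l * mat 1 $ snd k $ snd l) *\<^sub>C \<pi> (unitary_cos V) x
      - \<i> *\<^sub>C (\<mu> $ fst k $ fst l * mat 1 $ snd k $ snd l) *\<^sub>C \<pi> (unitary_sin V) x" for k l x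
    by (simp add: kick_A_def kick_def mat_def rep_diff[OF assms] rep_scaleC[OF assms]
        rep_zero[OF assms] scaleC_scaleC)
  then show ?thesis
    by (simp add: vec_eq_iff matrix_op_def[OF assms] tensor_op_def scaleC_vec_def scaleC_sum_right
        sum_subtractf)
qed

lemma matrix_op_kick_B:
  assumes "representation \<pi>"
  shows "matrix_op \<pi> (kick_B \<mu> V) \<Psi> = tensor_op (mat 1) (mat 1) (\<pi> (unitary_cos V)) \<Psi>
     - \<i> *\<^sub>C tensor_op (mat 1) \<mu> (\<pi> (unitary_sin V)) \<Psi>"
proof -
  have "\<pi> (kick_B \<mu> V $ k $ l) x =
      (mat 1 $ fst k $ fst l * mat 1 $ snd k $ snd l) *\<^sub>C \<pi> (unitary_cos V) x
      - \<i> *\<^sub>C (mat 1 $ fst k $ fst l * \<mu> $ snd k $ snd l) *\<^sub>C \<pi> (unitary_sin V) x" for k l x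
    by (simp add: kick_B_def kick_def mat_def rep_diff[OF assms] rep_scaleC[OF assms]
        rep_zero[OF assms] scaleC_scaleC)
  then show ?thesis
    by (simp add: vec_eq_iff matrix_op_def[OF assms] tensor_op_def scaleC_vec_def scaleC_sum_right
        sum_subtractf)
qed

text \<open>A kick is a linear combination of \<open>V\<close> and \<open>dagger V\<close>, both
  unitary, so the closure properties of \<open>cyclic_elements\<close> apply.\<close>

lemma kick_mult_cyclic:
  assumes "representation \<pi>" "represents_state \<pi> \<rho> \<omega>" "is_state \<omega>"
    and V: "unitary V" and X: "X \<in> cyclic_elements \<pi> \<rho> \<omega>"
  shows "kick \<mu> V i j * X \<in> cyclic_elements \<pi> \<rho> \<omega>"
proof -
  note add = add_cyclic[OF assms(1-3)] and scaleC = scaleC_cyclic[OF assms(1-3)]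
    and mult = unitary_mult_cyclic[OF assms(1-3) _ X]
  \<comment> \<open>The coefficient \<open>- \<mu> $ i $ j / 2\<close> is \<open>- \<i>\<close>
    times \<open>1 / (2 * \<i>)\<close> times the monopole entry. The difference is written as a sum
    with scalar \<open>-1\<close> to match the closure lemmas.\<close>
  have "kick \<mu> V i j * X =
      (if i = j then 1 / 2 else 0) *\<^sub>C (V * X + dagger V * X)
      + (- \<mu> $ i $ j / 2) *\<^sub>C (V * X + (-1) *\<^sub>C (dagger V * X))"
    by (simp add: kick_def unitary_cos_def unitary_sin_def scaleC_mult_left scaleC_scaleC
        scaleC_minus_left scaleC_add_right scaleC_diff_right algebra_simps)
  then show ?thesis
    using mult[OF V] mult[OF unitary_dagger[OF V]] by (simp only: add scaleC)
qed

text \<open>The algebraic core: the field enters only through unitaries \<open>U\<close> and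
  \<open>V\<close> that commute and through the common value \<open>z\<close> of the state on the
  squares of \<open>V\<close> and \<open>dagger V\<close>.\<close>

lemma pauli_channel_entries:
  fixes A :: "'a detector" and B :: "'b detector"
  assumes rep: "representation \<pi>" and rho: "represents_state \<pi> \<rho> \<omega>" and state: "is_state \<omega>"
    and U: "unitary U" and V: "unitary V" and comm: "V * U = U * V"
    and z: "\<omega> (V * V) = z" "\<omega> (dagger V * dagger V) = z"
  defines "T \<equiv> matrix_op \<pi> (kick_B (monopole B) V) \<circ> matrix_op \<pi> (kick_A (monopole A) U)"
  shows "partial_trace_A_field (T \<circ> tensor_op (ketbra Exc Exc) \<sigma> \<rho> \<circ> adjoint_op T) $ b $ b' =
    (1 + z) / 2 * \<sigma> $ b $ b' + (1 - z) / 2 * (monopole B ** \<sigma> ** monopole B) $ b $ b'"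
proof -
  define u where "u = kick_B (monopole B) V ** kick_A (monopole A) U"
  let ?kA = "kick (monopole A) U" and ?kB = "kick (monopole B) V"
  have u: "u $ k $ l = ?kB (snd k) (snd l) * ?kA (fst k) (fst l)" for k l
    by (simp add: u_def kick_B_kick_A)
  have T: "T = matrix_op \<pi> u"
    by (simp add: T_def u_def matrix_op_comp[OF rep])
  have "?kA i j \<in> cyclic_elements \<pi> \<rho> \<omega>" for i j
    using kick_mult_cyclic[OF rep rho state U one_cyclic[OF rep rho state]] by simp
  then have cyc: "u $ k $ l \<in> cyclic_elements \<pi> \<rho> \<omega>" for k l
    by (simp add: u kick_mult_cyclic[OF rep rho state V])
  \<comment> \<open>Tracing out \<open>A\<close> removes every trace of its kick from the
    expectation value.\<close>
  have trace_A: "(\<Sum>a\<in>UNIV. \<omega> (dagger (?kB i' j' * ?kA a Exc) * (?kB i j * ?kA a Exc)))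
      = \<omega> (dagger (?kB i' j') * ?kB i j)" for i j i' j'
  proof -
    let ?Z = "dagger (?kB i' j') * ?kB i j"
    \<comment> \<open>By unitarity, commutation of \<open>U\<close> with \<open>V\<close> extends to
      their adjoints, and so to everything built from them.\<close>
    have UV: "U * V = V * U" "V * dagger U = dagger U * V"
      using comm commute_dagger_unitary[OF U comm] by simp_all
    have Z: "x * ?Z = ?Z * x" if "x * V = V * x" "x * dagger V = dagger V * x" for x
    proof -
      have "x * ?Z = (dagger (?kB i' j') * x) * ?kB i j"
        using commute_kick(2)[OF that] by (simp flip: mult.assoc)
      also have "\<dots> = ?Z * x"
        using commute_kick(1)[OF that] by (simp add: mult.assoc)
      finally show ?thesis .
    qed
    have "?Z * U = U * ?Z" "?Z * dagger U = dagger U * ?Z"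
      using Z[OF UV(1) commute_dagger_unitary[OF V UV(1)]]
        Z[OF UV(2)[symmetric] commute_dagger_unitary[OF V UV(2)[symmetric]]] by simp_all
    \<comment> \<open>\<open>?Z\<close> can now pass the adjoint kick of \<open>A\<close>, so the
      two factors of \<open>A\<close> become adjacent and their sum over \<open>a\<close> is
      1.\<close>
    note ZkA = commute_kick(2)[OF this]
    have "dagger (?kB i' j' * ?kA a Exc) * (?kB i j * ?kA a Exc)
        = ?Z * (dagger (?kA a Exc) * ?kA a Exc)" for a
    proof -
      have "dagger (?kB i' j' * ?kA a Exc) * (?kB i j * ?kA a Exc)
          = (dagger (?kA a Exc) * ?Z) * ?kA a Exc"
        by (simp add: dagger_mult mult.assoc)
      also have "\<dots> = ?Z * (dagger (?kA a Exc) * ?kA a Exc)"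
        unfolding ZkA[symmetric] by (simp only: mult.assoc)
      finally show ?thesis .
    qed
    then have "(\<Sum>a\<in>UNIV. \<omega> (dagger (?kB i' j' * ?kA a Exc) * (?kB i j * ?kA a Exc)))
        = \<omega> (?Z * (\<Sum>a\<in>UNIV. dagger (?kA a Exc) * ?kA a Exc))"
      by (simp add: sum_level state_add[OF state] distrib_left)
    then show ?thesis
      by (simp add: sum_dagger_kick_monopole[OF U])
  qed
  have "partial_trace_A_field (T \<circ> tensor_op (ketbra Exc Exc) \<sigma> \<rho> \<circ> adjoint_op T) $ b $ b'
      = (\<Sum>a\<in>UNIV. \<Sum>\<beta>\<in>UNIV. \<Sum>\<beta>'\<in>UNIV. \<sigma> $ \<beta> $ \<beta>' *
          \<omega> (dagger (?kB b' \<beta>' * ?kA a Exc) * (?kB b \<beta> * ?kA a Exc)))"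
    \<comment> \<open>The factor \<open>ketbra Exc Exc\<close> keeps only the terms in which
      \<open>A\<close> starts excited on both sides.\<close>
    unfolding T partial_trace_sandwich[OF rep rho state cyc]
    by (simp add: sum_level_prod sum_level ketbra_def u)
  also have "\<dots> = (\<Sum>\<beta>\<in>UNIV. \<Sum>\<beta>'\<in>UNIV. \<sigma> $ \<beta> $ \<beta>' *
      (\<Sum>a\<in>UNIV. \<omega> (dagger (?kB b' \<beta>' * ?kA a Exc) * (?kB b \<beta> * ?kA a Exc))))"
    by (simp add: sum_level algebra_simps)
  also have "\<dots> = (\<Sum>\<beta>\<in>UNIV. \<Sum>\<beta>'\<in>UNIV. \<sigma> $ \<beta> $ \<beta>' *
      ((if b' = \<beta>' \<and> b = \<beta> then 1 else 0) * (1 + z) / 2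
       + cnj (monopole B $ b' $ \<beta>') * monopole B $ b $ \<beta> * (1 - z) / 2))"
    by (simp only: trace_A state_dagger_kick_kick[OF state V z])
  \<comment> \<open>The monopole is Hermitian, so the conjugated entry is the right-hand factor in
    the product of \<open>monopole B\<close>, \<open>\<sigma>\<close> and
    \<open>monopole B\<close>.\<close>
  also have "\<dots> = (1 + z) / 2 * \<sigma> $ b $ b' + (1 - z) / 2 * (monopole B ** \<sigma> ** monopole B) $ b $ b'"
    by (cases b; cases b')
      (simp_all add: sum_level matrix_matrix_mult_def monopole_entries field_simps)
  finally show ?thesis .
qed

section \<open>The Weyl generators\<close>

text \<open>Together with \<open>klein_gordon_zero\<close>, this lets the relation that
  \<open>W\<close> is 1 on \<open>E (P f)\<close> be used at \<open>f = 0\<close>, which yields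
  \<open>weyl_zero\<close>.\<close>

lemma zero_test_function: "(\<lambda>x. 0) \<in> test_functions M"
proof -
  have "Ck_on k S (\<lambda>y. 0)" for k S
    by (induction k) (simp_all add: pd_def[abs_def])
  then show ?thesis
    by (simp add: test_functions_def smooth_functions_def smooth_on_def in_chart_def[abs_def] supp_def)
qed

lemma klein_gordon_zero: "klein_gordon M m \<xi> (\<lambda>x. 0) = (\<lambda>x. 0)"
  by (simp add: klein_gordon_def[abs_def] box_op_def in_chart_def[abs_def] pd_def[abs_def] Let_def)

lemma prop_dist_minus: "prop_dist M E (\<lambda>h. - f h) = (\<lambda>h. - prop_dist M E f h)"
  by (auto simp: prop_dist_def)

context
  fixes M :: "'a::topological_space spacetime" and m \<xi> :: real
    and E :: "('a \<Rightarrow> real) \<Rightarrow> 'a \<Rightarrow> real" and \<F> :: "'a distribution set"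
    and EE :: "'a distribution \<Rightarrow> 'a distribution \<Rightarrow> real"
    and W :: "'a distribution \<Rightarrow> 'w::unital_cstar_algebra"
  assumes smear: "smearing_class M E \<F> EE" and weyl: "weyl_algebra M m \<xi> E \<F> EE W"
begin

lemma smearing_zero: "(\<lambda>h. 0) \<in> \<F>"
proof -
  have "dist_of M (\<lambda>x. 0) \<in> \<F>"
    using smear zero_test_function by (auto simp: smearing_class_def)
  then show ?thesis
    by (simp add: dist_of_def)
qed

lemma smearing_linear:
  assumes "f \<in> \<F>" "g \<in> \<F>"
  shows "(\<lambda>h. r * f h + g h) \<in> \<F>"
  using smear assms unfolding smearing_class_def by blast

lemma smearing_minus: "f \<in> \<F> \<Longrightarrow> (\<lambda>h. - f h) \<in> \<F>"
  using smearing_linear[OF _ smearing_zero, of f "-1"] by simp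

lemma smearing_add: "f \<in> \<F> \<Longrightarrow> g \<in> \<F> \<Longrightarrow> (\<lambda>h. f h + g h) \<in> \<F>"
  using smearing_linear[of f g 1] by simp

lemma EE_antisym: "f \<in> \<F> \<Longrightarrow> g \<in> \<F> \<Longrightarrow> EE f g = - EE g f"
  using smear unfolding smearing_class_def by blast

lemma EE_linear:
  assumes "f \<in> \<F>" "g \<in> \<F>" "k \<in> \<F>"
  shows "EE (\<lambda>h. r * f h + g h) k = r * EE f k + EE g k"
  using smear assms unfolding smearing_class_def by blast

text \<open>Antisymmetry forces \<open>EE f f = 0\<close>. Thus the Weyl phase in the product of the
  generators for \<open>f\<close> and \<open>-f\<close> is trivial, as \<open>weyl_unitary\<close>
  requires.\<close>

lemma EE_minus_self:
  assumes f: "f \<in> \<F>"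
  shows "EE f (\<lambda>h. - f h) = 0"
proof -
  \<comment> \<open>Linearity at zero arguments with \<open>r = 1\<close> says that this value
    equals twice itself.\<close>
  have "EE (\<lambda>h. 0) f = 0"
    using EE_linear[OF smearing_zero smearing_zero f, of 1] by simp
  then have "EE (\<lambda>h. - f h) f = - EE f f"
    using EE_linear[OF f smearing_zero f, of "-1"] by simp
  then show ?thesis
    using EE_antisym[OF f f] EE_antisym[OF f smearing_minus[OF f]] by simp
qed

lemma weyl_mult:
  assumes "f \<in> \<F>" "g \<in> \<F>"
  shows "W (prop_dist M E f) * W (prop_dist M E g) =
        exp (- (\<i> / 2) * complex_of_real (EE f g)) *\<^sub>C W (prop_dist M E (\<lambda>h. f h + g h))"
  using weyl assms unfolding weyl_algebra_def by blast

lemma weyl_dagger: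
  assumes "f \<in> \<F>"
  shows "dagger (W (prop_dist M E f)) = W (prop_dist M E (\<lambda>h. - f h))"
  using weyl assms unfolding weyl_algebra_def prop_dist_minus by blast

lemma weyl_zero: "W (prop_dist M E (\<lambda>h. 0)) = 1"
proof -
  have "W (prop_dist M E (dist_of M (klein_gordon M m \<xi> (\<lambda>x. 0)))) = 1"
    using weyl zero_test_function unfolding weyl_algebra_def by blast
  then show ?thesis
    by (simp add: klein_gordon_zero dist_of_def)
qed

lemma weyl_unitary:
  assumes f: "f \<in> \<F>"
  shows "unitary (W (prop_dist M E f))"
  using weyl_mult[OF f smearing_minus[OF f]] weyl_mult[OF smearing_minus[OF f] f]
    EE_minus_self[OF f] EE_antisym[OF f smearing_minus[OF f]]
  by (simp add: unitary_def weyl_dagger[OF f] weyl_zero)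

lemma cos_field_eq:
  assumes "f \<in> \<F>"
  shows "cos_field M E W f = unitary_cos (W (prop_dist M E f))"
  by (simp add: cos_field_def unitary_cos_def weyl_dagger[OF assms] prop_dist_minus)

lemma sin_field_eq:
  assumes "f \<in> \<F>"
  shows "sin_field M E W f = unitary_sin (W (prop_dist M E f))"
  by (simp add: sin_field_def unitary_sin_def weyl_dagger[OF assms] prop_dist_minus)

text \<open>Causality makes both Weyl phases 1, so either product is the generator of the
  sum.\<close>

lemma weyl_commute:
  assumes f: "f \<in> \<F>" and g: "g \<in> \<F>"
    and sep: "spacelike_separated M (dist_supp M f) (dist_supp M g)"
  shows "W (prop_dist M E g) * W (prop_dist M E f) = W (prop_dist M E f) * W (prop_dist M E g)"
proof -
  have "EE f g = 0"
    using smear f g sep unfolding smearing_class_def by blast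
  then show ?thesis
    using EE_antisym[OF f g] by (simp add: weyl_mult f g add.commute)
qed

section \<open>Expectation values in a quasifree state, and the resulting channel\<close>

context
  fixes \<mu> :: "'a distribution \<Rightarrow> 'a distribution \<Rightarrow> real" and \<omega> :: "'w \<Rightarrow> complex"
  assumes quasifree: "quasifree_state M E \<F> EE W \<mu> \<omega>"
begin

lemma quasifree_is_state: "is_state \<omega>"
  using quasifree by (simp add: quasifree_state_def)

lemma quasifree_inner_linear:
  assumes "u \<in> prop_dist M E ` \<F>" "v \<in> prop_dist M E ` \<F>" "w \<in> prop_dist M E ` \<F>"
  shows "\<mu> (\<lambda>h. r * u h + v h) w = r * \<mu> u w + \<mu> v w"
  using quasifree assms unfolding quasifree_state_def real_inner_product_on_def by blast

lemma quasifree_inner_double: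
  assumes u: "u \<in> prop_dist M E ` \<F>" and uu: "(\<lambda>h. u h + u h) \<in> prop_dist M E ` \<F>"
  shows "\<mu> (\<lambda>h. u h + u h) (\<lambda>h. u h + u h) = 4 * \<mu> u u"
proof -
  have sym: "\<mu> u (\<lambda>h. u h + u h) = \<mu> (\<lambda>h. u h + u h) u"
    using quasifree u uu unfolding quasifree_state_def real_inner_product_on_def by blast
  show ?thesis
    using quasifree_inner_linear[OF u u uu, of 1] quasifree_inner_linear[OF u u u, of 1] sym by simp
qed

text \<open>Strict positivity is given for nonzero vectors; at zero, linearity forces the value
  0.\<close>

lemma quasifree_inner_nonneg:
  assumes u: "u \<in> prop_dist M E ` \<F>"
  shows "0 \<le> \<mu> u u"
proof (cases "u = (\<lambda>h. 0)")
  case True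
  then show ?thesis
    using quasifree_inner_linear[OF u u u, of 1] by simp
next
  case False
  then show ?thesis
    using quasifree u unfolding quasifree_state_def real_inner_product_on_def by (metis less_imp_le)
qed

text \<open>The square is the generator of the doubled smearing. Doubling multiplies
  \<open>\<mu>\<close> by 4, and the half in the quasifree formula leaves the exponent
  \<open>-2\<close>.\<close>

lemma quasifree_weyl_square:
  assumes f: "f \<in> \<F>"
  shows "\<omega> (W (prop_dist M E f) * W (prop_dist M E f)) =
    complex_of_real (exp (- 2 * \<mu> (prop_dist M E f) (prop_dist M E f)))"
proof -
  let ?u = "prop_dist M E f"
  have double: "prop_dist M E (\<lambda>h. f h + f h) = (\<lambda>h. ?u h + ?u h)"
    by (auto simp: prop_dist_def)
  have ff: "(\<lambda>h. f h + f h) \<in> \<F>"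
    using f by (rule smearing_add[OF _ f])
  have "\<mu> (\<lambda>h. ?u h + ?u h) (\<lambda>h. ?u h + ?u h) = 4 * \<mu> ?u ?u"
    using f ff double by (intro quasifree_inner_double) (auto intro: rev_image_eqI)
  moreover have "\<omega> (W (prop_dist M E (\<lambda>h. f h + f h))) = complex_of_real (exp
      (- \<mu> (\<lambda>h. ?u h + ?u h) (\<lambda>h. ?u h + ?u h) / 2))"
    using quasifree ff unfolding quasifree_state_def double[symmetric] by blast
  moreover have "EE f f = 0"
    using EE_antisym[OF f f] by simp
  ultimately show ?thesis
    by (simp add: weyl_mult[OF f f])
qed

text \<open>The adjoint is the generator of \<open>-f\<close>, and \<open>\<mu>\<close> takes the
  same value on a vector and on its negative.\<close>

lemma quasifree_weyl_dagger_square: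
  assumes f: "f \<in> \<F>"
  shows "\<omega> (dagger (W (prop_dist M E f)) * dagger (W (prop_dist M E f))) =
    complex_of_real (exp (- 2 * \<mu> (prop_dist M E f) (prop_dist M E f)))"
proof -
  let ?u = "prop_dist M E f" and ?v = "prop_dist M E (\<lambda>h. - f h)"
  have im: "?u \<in> prop_dist M E ` \<F>" "?v \<in> prop_dist M E ` \<F>"
      "(\<lambda>h. 0) \<in> prop_dist M E ` \<F>"
    using f smearing_minus[OF f] smearing_zero
    by (auto intro!: image_eqI[of _ _ "\<lambda>h. 0"] simp: prop_dist_def)
  \<comment> \<open>The second instance of linearity gives that \<open>\<mu>\<close> vanishes when
    its first argument is zero.\<close>
  have neg: "\<mu> ?v w = - \<mu> ?u w" if "w \<in> prop_dist M E ` \<F>" for w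
    using quasifree_inner_linear[OF im(1,3) that, of "-1"]
      quasifree_inner_linear[OF im(3,3) that, of 1] by (simp add: prop_dist_minus)
  have "\<mu> ?u ?v = \<mu> ?v ?u"
    using quasifree im unfolding quasifree_state_def real_inner_product_on_def by blast
  then have "\<mu> ?v ?v = \<mu> ?u ?u"
    using neg[OF im(1)] neg[OF im(2)] by simp
  then show ?thesis
    by (simp add: weyl_dagger[OF f] quasifree_weyl_square[OF smearing_minus[OF f]])
qed

lemma Re_wightman_nonneg:
  assumes "f \<in> \<F>"
  shows "0 \<le> Re (wightman M E EE \<mu> f f)"
  using quasifree_inner_nonneg assms by (simp add: wightman_def)

lemma detector_channel_eq:
  assumes rep: "representation \<pi>" and rho: "represents_state \<pi> \<rho>\<phi> \<omega>"
    and pair: "detector_pair M \<F> \<eta> A B"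
    and sep: "spacelike_separated M (dist_supp M (delta_smearing M \<eta> A)) (dist_supp M (delta_smearing M \<eta> B))"
  defines "p \<equiv> (1 - exp (- 2 * Re (wightman M E EE \<mu> (delta_smearing M \<eta> B) (delta_smearing M \<eta> B)))) / 2"
  shows "detector_channel M E W \<pi> \<rho>\<phi> \<eta> A B \<sigma> =
    (1 - p) *\<^sub>R \<sigma> + p *\<^sub>R (monopole B ** \<sigma> ** monopole B)"
proof -
  let ?fA = "delta_smearing M \<eta> A" and ?fB = "delta_smearing M \<eta> B"
  have fA: "?fA \<in> \<F>" and fB: "?fB \<in> \<F>"
    using pair by (simp_all add: detector_pair_def)
  define z where "z = exp (- 2 * \<mu> (prop_dist M E ?fB) (prop_dist M E ?fB))"
  have p: "p = (1 - z) / 2" "1 - p = (1 + z) / 2"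
    by (simp_all add: p_def z_def wightman_def field_simps)
  have UA: "U_A M E W \<pi> \<eta> A = matrix_op \<pi> (kick_A (monopole A) (W (prop_dist M E ?fA)))"
    by (simp add: fun_eq_iff U_A_def cos_field_eq[OF fA] sin_field_eq[OF fA] matrix_op_kick_A[OF rep])
  have UB: "U_B M E W \<pi> \<eta> B = matrix_op \<pi> (kick_B (monopole B) (W (prop_dist M E ?fB)))"
    by (simp add: fun_eq_iff U_B_def cos_field_eq[OF fB] sin_field_eq[OF fB] matrix_op_kick_B[OF rep])
  have "detector_channel M E W \<pi> \<rho>\<phi> \<eta> A B \<sigma> $ b $ b' =
      (1 + complex_of_real z) / 2 * \<sigma> $ b $ b'
      + (1 - complex_of_real z) / 2 * (monopole B ** \<sigma> ** monopole B) $ b $ b'" for b b'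
    unfolding detector_channel_def Let_def UA UB
    by (rule pauli_channel_entries[OF rep rho quasifree_is_state weyl_unitary[OF fA]
          weyl_unitary[OF fB] weyl_commute[OF fA fB sep]])
      (simp_all only: z_def quasifree_weyl_square[OF fB] quasifree_weyl_dagger_square[OF fB])
  then show ?thesis
    unfolding vec_eq_iff vector_add_component vector_scaleR_component p(2)
    by (simp add: scaleR_conv_of_real p(1))
qed

end
end

section \<open>The excitation probability and the final statement\<close>

lemma excitation_prob_pauli_ground:
  "excitation_prob ((1 - p) *\<^sub>R ketbra Gnd Gnd + p *\<^sub>R (monopole B ** ketbra Gnd Gnd ** monopole B)) = p\<^sup>2"
proof -
  define c where "c = cis (energy_gap B * instant B)"
  \<comment> \<open>The flipped ground state is the excited state with unit weight, so the matrix
    element is \<open>p\<close>; the square comes from \<open>excitation_prob\<close>.\<close>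
  have "c * cnj c = 1"
    by (simp add: c_def cis_cnj cis_mult)
  then show ?thesis
    by (simp add: excitation_prob_def ketbra_def matrix_matrix_mult_def sum_level monopole_entries
        flip: c_def)
qed

theorem mainTheorem1:
  fixes M :: "'a::{second_countable_topology, t2_space} spacetime"
    and m \<xi> \<eta> :: real
    and Eret Eadv E :: "('a \<Rightarrow> real) \<Rightarrow> 'a \<Rightarrow> real"
    and \<F> :: "'a distribution set"
    and EE \<mu> :: "'a distribution \<Rightarrow> 'a distribution \<Rightarrow> real"
    and W :: "'a distribution \<Rightarrow> 'w::unital_cstar_algebra"
    and \<omega> :: "'w \<Rightarrow> complex"
    and \<pi> :: "'w \<Rightarrow> 'h::complex_hilbert \<Rightarrow> 'h"
    and \<rho>\<phi> :: "'h \<Rightarrow> 'h"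
  assumes "globally_hyperbolic M"
    and "\<xi> \<ge> 0"
    and "retarded_propagator M m \<xi> Eret"
    and "advanced_propagator M m \<xi> Eadv"
    and "E = causal_propagator Eret Eadv"
    and "smearing_class M E \<F> EE"
    and "weyl_algebra M m \<xi> E \<F> EE W"
    and "quasifree_state M E \<F> EE W \<mu> \<omega>"
    and "representation \<pi>"
    and "represents_state \<pi> \<rho>\<phi> \<omega>"
  shows "(\<forall>A B \<rho>B. detector_pair M \<F> \<eta> A B \<and>
            spacelike_separated M (dist_supp M (delta_smearing M \<eta> A)) (dist_supp M (delta_smearing M \<eta> B)) \<and>
            density_matrix \<rho>B \<longrightarrow>
            (let fB = delta_smearing M \<eta> B;
                 p = (1 - exp (- 2 * Re (wightman M E EE \<mu> fB fB))) / 2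
             in 0 \<le> p \<and> p \<le> 1 \<and>
                detector_channel M E W \<pi> \<rho>\<phi> \<eta> A B \<rho>B =
                  (1 - p) *\<^sub>R \<rho>B + p *\<^sub>R (monopole B ** \<rho>B ** monopole B)))
       \<and> (\<exists>Q :: 'a distribution \<Rightarrow> real. \<forall>A B. detector_pair M \<F> \<eta> A B \<and>
            spacelike_separated M (dist_supp M (delta_smearing M \<eta> A)) (dist_supp M (delta_smearing M \<eta> B)) \<longrightarrow>
            excitation_prob (detector_channel M E W \<pi> \<rho>\<phi> \<eta> A B (ketbra Gnd Gnd)) = Q (delta_smearing M \<eta> B))
       \<and> (\<forall>A A' B \<rho>B. detector_pair M \<F> \<eta> A B \<and> detector_pair M \<F> \<eta> A' B \<and>
            spacelike_separated M (dist_supp M (delta_smearing M \<eta> A)) (dist_supp M (delta_smearing M \<eta> B)) \<and>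
            spacelike_separated M (dist_supp M (delta_smearing M \<eta> A')) (dist_supp M (delta_smearing M \<eta> B)) \<and>
            density_matrix \<rho>B \<longrightarrow>
            excitation_prob (detector_channel M E W \<pi> \<rho>\<phi> \<eta> A B \<rho>B) =
            excitation_prob (detector_channel M E W \<pi> \<rho>\<phi> \<eta> A' B \<rho>B))"
proof -
  note channel = detector_channel_eq[OF assms(6-10)]
  have prob: "0 \<le> (1 - exp (- 2 * Re (wightman M E EE \<mu> f f))) / 2
      \<and> (1 - exp (- 2 * Re (wightman M E EE \<mu> f f))) / 2 \<le> 1" if "f \<in> \<F>" for f
    using Re_wightman_nonneg[OF assms(6-8) that] by (simp add: order_trans[OF _ exp_ge_zero])
  show ?thesis
  proof (intro conjI)
    show "\<exists>Q :: 'a distribution \<Rightarrow> real. \<forall>A B. detector_pair M \<F> \<eta> A B \<and>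
            spacelike_separated M (dist_supp M (delta_smearing M \<eta> A)) (dist_supp M (delta_smearing M \<eta> B)) \<longrightarrow>
            excitation_prob (detector_channel M E W \<pi> \<rho>\<phi> \<eta> A B (ketbra Gnd Gnd)) = Q (delta_smearing M \<eta> B)"
      \<comment> \<open>The witness is the square of the flip probability \<open>p\<close>, as a
        function of the smearing of \<open>B\<close> alone.\<close>
      by (rule exI[of _ "\<lambda>f. ((1 - exp (- 2 * Re (wightman M E EE \<mu> f f))) / 2)\<^sup>2"])
        (auto simp: channel excitation_prob_pauli_ground)
  \<comment> \<open>For two choices of the first detector, both channels equal the same Pauli
    expression, whatever the initial state of \<open>B\<close>.\<close>
  qed (use prob in \<open>auto simp: channel Let_def detector_pair_def\<close>)
qed

end
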